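(* Let $C$ be a sufficiently large constant. Set $n_1=2^C$, $n_i=n_{i-1}^4$ for $i>1$, and $m_i=n_i^{100}$ for $i\ge 1$. Set $p_1=0.6$ and $p_i=p_{i-1}+1/(10i^2)$ for $i>1$. Let $t\ge 1$ be an integer and let $\{Q_{i,j}\}_{1\le j\le i\le t}$ be randomized communication protocols such that: - In each $Q_{i,j}$, Alice receives $\vec X=(X_1,\dots,X_t)$ and Bob receives $\vec Y=(Y_1,\dots,Y_t)$, where each $(X_\ell,Y_\ell)$ is an instance of $\textsc{XOR-Missing-String}(n_\ell,m_\ell)$. - The complexity of each $Q_{i,j}$ is at most $n_i^4$, and $Q_{i,j}$ outputs a string of length $n_i$. Then there is a choice of inputs $\{(X_\ell,Y_\ell)\}_{\ell\le t}$ such that, for every $1\le j\le i\le t$, one of the following holds: - no string is output by $Q_{i,j}(\vec X,\vec Y)$ with probability greater than $p_t$; or - the unique string output by $Q_{i,j}(\vec X,\vec Y)$ with probability greater than $p_t$ is not a solution to $\textsc{XOR-Missing-String}$ on $(X_i,Y_i)$.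
   Context: $\textsc{XOR-Missing-String}(n,m)$, for $m<2^{n/2}$: Alice gets $X=(x_1,\dots,x_m)$ and Bob gets $Y=(y_1,\dots,y_m)$, with all strings in $\{0,1\}^n$. A string $s\in\{0,1\}^n$ is a solution on $(X,Y)$ if $s\ne x_i\oplus y_j$ for all $i,j$. A randomized communication protocol uses public randomness. Its complexity is the maximum number of bits communicated plus the number of random bits used. *)

theory Defs
  imports "HOL-Probability.Probability"
begin

definition bitstrings :: "nat \<Rightarrow> bool list set" where
  "bitstrings n = {s. length s = n}"

definition xor_string :: "bool list \<Rightarrow> bool list \<Rightarrow> bool list" where
  "xor_string x y = map2 (\<noteq>) x y"

text \<open>
  The first component is Alice's list and the second one is Bob's. The problem is only
  defined for \<open>m < 2 powr (n / 2)\<close>, so there are no instances for other parameters.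
\<close>

definition xor_missing_string_instances :: "nat \<Rightarrow> nat \<Rightarrow> (bool list list \<times> bool list list) set" where
  "xor_missing_string_instances n m =
     {(X, Y). real m < 2 powr (real n / 2) \<and>
        length X = m \<and> set X \<subseteq> bitstrings n \<and> length Y = m \<and> set Y \<subseteq> bitstrings n}"

definition xor_missing_string_solution ::
    "nat \<Rightarrow> nat \<Rightarrow> bool list list \<Rightarrow> bool list list \<Rightarrow> bool list \<Rightarrow> bool" where
  "xor_missing_string_solution n m X Y s \<longleftrightarrow>
     s \<in> bitstrings n \<and> (\<forall>i<m. \<forall>j<m. s \<noteq> xor_string (X ! i) (Y ! j))"

text \<open>
  Two-party protocol trees: at an inner node one player sends one bit, computed from that
  player's own input and the position in the tree (equivalently, the transcript so far).
  If the bit is true the protocol continues in the first subtree, otherwise in the second.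
  The output is determined by the leaf reached.
\<close>

datatype ('a, 'b, 'o) protocol =
    Output 'o
  | Alice_Sends "'a \<Rightarrow> bool" "('a, 'b, 'o) protocol" "('a, 'b, 'o) protocol"
  | Bob_Sends "'b \<Rightarrow> bool" "('a, 'b, 'o) protocol" "('a, 'b, 'o) protocol"

primrec run_protocol :: "('a, 'b, 'o) protocol \<Rightarrow> 'a \<Rightarrow> 'b \<Rightarrow> 'o" where
  "run_protocol (Output z) x y = z"
| "run_protocol (Alice_Sends f P Q) x y = (if f x then run_protocol P x y else run_protocol Q x y)"
| "run_protocol (Bob_Sends g P Q) x y = (if g y then run_protocol P x y else run_protocol Q x y)"

primrec bits_communicated :: "('a, 'b, 'o) protocol \<Rightarrow> 'a \<Rightarrow> 'b \<Rightarrow> nat" where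
  "bits_communicated (Output z) x y = 0"
| "bits_communicated (Alice_Sends f P Q) x y =
     Suc (if f x then bits_communicated P x y else bits_communicated Q x y)"
| "bits_communicated (Bob_Sends g P Q) x y =
     Suc (if g y then bits_communicated P x y else bits_communicated Q x y)"

text \<open>
  Public randomness: both players see the same uniformly random string of
  \<open>random_bits\<close> bits, which selects the protocol tree that they follow.
\<close>

record ('a, 'b, 'o) randomized_protocol =
  random_bits :: nat
  tree_of :: "bool list \<Rightarrow> ('a, 'b, 'o) protocol"

definition output_distribution :: "('a, 'b, 'o) randomized_protocol \<Rightarrow> 'a \<Rightarrow> 'b \<Rightarrow> 'o pmf" where
  "output_distribution Q x y =
     map_pmf (\<lambda>r. run_protocol (tree_of Q r) x y) (pmf_of_set (bitstrings (random_bits Q)))"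

text \<open>
  In the following, \<open>D\<close> is the (finite, nonempty) set of possible input pairs.
\<close>

definition complexity :: "('a \<times> 'b) set \<Rightarrow> ('a, 'b, 'o) randomized_protocol \<Rightarrow> nat" where
  "complexity D Q =
     Max {bits_communicated (tree_of Q r) x y | r x y. r \<in> bitstrings (random_bits Q) \<and> (x, y) \<in> D}
     + random_bits Q"

definition outputs_strings_of_length ::
    "('a \<times> 'b) set \<Rightarrow> ('a, 'b, bool list) randomized_protocol \<Rightarrow> nat \<Rightarrow> bool" where
  "outputs_strings_of_length D Q n \<longleftrightarrow>
     (\<forall>(x, y) \<in> D. \<forall>r \<in> bitstrings (random_bits Q). run_protocol (tree_of Q r) x y \<in> bitstrings n)"

text \<open>The sequences are indexed from 1; their values at index 0 are irrelevant.\<close>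

fun n_seq :: "nat \<Rightarrow> nat \<Rightarrow> nat" where
  "n_seq C i = (if i \<le> 1 then 2 ^ C else n_seq C (i - 1) ^ 4)"

definition m_seq :: "nat \<Rightarrow> nat \<Rightarrow> nat" where
  "m_seq C i = n_seq C i ^ 100"

fun p_seq :: "nat \<Rightarrow> real" where
  "p_seq i = (if i \<le> 1 then 0.6 else p_seq (i - 1) + 1 / (10 * real i ^ 2))"

declare n_seq.simps [simp del] p_seq.simps [simp del]

text \<open>
  A vector indexed by \<open>1, \<dots>, t\<close> is a function on \<open>nat\<close> that is \<open>undefined\<close> off \<open>{1..t}\<close>,
  so the set of input vectors below is finite.
\<close>

definition input_vectors ::
    "nat \<Rightarrow> nat \<Rightarrow> ((nat \<Rightarrow> bool list list) \<times> (nat \<Rightarrow> bool list list)) set" where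
  "input_vectors C t =
     {(X, Y). X \<in> extensional {1..t} \<and> Y \<in> extensional {1..t} \<and>
        (\<forall>l\<in>{1..t}. (X l, Y l) \<in> xor_missing_string_instances (n_seq C l) (m_seq C l))}"

end

theory Submission
  imports Defs
begin

text \<open>
  Keep a rectangle \<open>A \<times> B\<close> of input vectors and treat the protocols one by one, lower levels first.
  For the protocol \<open>Q\<^sub>i\<^sub>j\<close>, sample \<open>n\<^sub>i\<close> seeds and pass to a leaf of the joint run: there the
  empirical output distribution is a fixed profile \<open>F\<close>, which is close in \<open>\<ell>\<^sub>2\<close> to the true output
  distribution on most inputs. At most one string \<open>s\<close> has \<open>F s > 0.55\<close>. Destroy it by
  restricting to the inputs with \<open>X\<^sub>i ! l = a\<close> and \<open>Y\<^sub>i ! l' = s \<oplus> a\<close>. Since \<open>m\<^sub>i\<close> is huge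
  compared with the logarithm of the inverse density of \<open>A \<times> B\<close>, most fibers of every large subrectangle have nearly the
  average size, so for some choice of \<open>l\<close>, \<open>l'\<close>, \<open>a\<close> all averages of cheap protocols are
  almost preserved. The squared \<open>\<ell>\<^sub>2\<close> error is such an average, being a collision statistic of two
  independent seeds. The losses are summable, so some input pair has a tiny total error: there
  every string of probability above \<open>0.6\<close> has \<open>F s > 0.55\<close> and has been destroyed.
\<close>

section \<open>Sums over lists and means\<close>

text \<open>The obstacle is that destroying a string shrinks the rectangle by an exponentially small
  factor, which could invalidate the profiles frozen for earlier protocols. Their quality is
  therefore carried as a single number, the mean of the summed squared errors over the current
  rectangle, and every move has to control that mean. Squared Euclidean distance suits this: K
  samples have expected error at most 1 / K whatever the number of strings, and an error estimate
  costs only two runs of the protocol.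

  Lower levels come first because of the budgets. Planting at level i is harmless only if m_i
  exceeds, by a wide margin, both the codensity exponent spent so far and the cost of every protocol
  whose error is to be preserved. Going upwards, these are bounded by polynomials in n_i of degree
  at most 20, against m_i = n_i ^ 100; going downwards, the exponent spent at a high level would
  dwarf m_i for a much lower one.

  The threshold 0.55 lies above 1 / 2, which makes the heavy string unique, and 0.05 below 0.6; the
  total mean error is kept below 1 / 800, half of 0.05 ^ 2.\<close>

definition lists_of_length :: "'a set \<Rightarrow> nat \<Rightarrow> 'a list set" where
  "lists_of_length V m = {xs. set xs \<subseteq> V \<and> length xs = m}"

lemma lists_of_length_0 [simp]: "lists_of_length V 0 = {[]}"
  by (auto simp: lists_of_length_def)

lemma finite_lists_of_length [simp]: "finite V \<Longrightarrow> finite (lists_of_length V m)"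
  unfolding lists_of_length_def by (rule finite_lists_length_eq)

lemma card_lists_of_length: "finite V \<Longrightarrow> card (lists_of_length V m) = card V ^ m"
  unfolding lists_of_length_def by (rule card_lists_length_eq)

lemma lists_of_length_nth: "xs \<in> lists_of_length V m \<Longrightarrow> l < m \<Longrightarrow> xs ! l \<in> V"
  by (auto simp: lists_of_length_def)

lemma sum_lists_of_length_Suc:
  "(\<Sum>xs\<in>lists_of_length V (Suc m). g xs) = (\<Sum>a\<in>V. \<Sum>xs\<in>lists_of_length V m. g (a # xs))"
proof -
  have "lists_of_length V (Suc m) = (\<lambda>(a, xs). a # xs) ` (V \<times> lists_of_length V m)"
    by (auto simp: lists_of_length_def image_iff length_Suc_conv)
  then have "(\<Sum>xs\<in>lists_of_length V (Suc m). g xs) =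
      (\<Sum>(a, xs)\<in>V \<times> lists_of_length V m. g (a # xs))"
    by (simp add: sum.reindex inj_on_def split_def)
  then show ?thesis
    by (simp add: sum.cartesian_product)
qed

lemma sum_prod_lists_of_length:
  fixes \<psi> :: "nat \<Rightarrow> 'v \<Rightarrow> real"
  shows "(\<Sum>xs\<in>lists_of_length V m. \<Prod>l<m. \<psi> l (xs ! l)) = (\<Prod>l<m. \<Sum>a\<in>V. \<psi> l a)"
proof (induction m arbitrary: \<psi>)
  case (Suc m)
  show ?case
    by (simp add: sum_lists_of_length_Suc prod.lessThan_Suc_shift del: prod.lessThan_Suc
        flip: sum_distrib_left Suc sum_distrib_right)
qed simp

lemma sum_sum_list_eq_0:
  fixes f :: "'a \<Rightarrow> real"
  assumes "(\<Sum>r\<in>S. f r) = 0"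
  shows "(\<Sum>rs\<in>lists_of_length S K. sum_list (map f rs)) = 0"
proof (induction K)
  case (Suc K)
  show ?case
    by (simp add: sum_lists_of_length_Suc sum.distrib Suc assms flip: sum_distrib_left)
qed simp

text \<open>Variance of a sum of K independent uniform samples: the cross terms vanish because
  \<open>f\<close> sums to zero. The factor \<open>card S\<close> on the left avoids the exponent K
  - 1.\<close>

lemma sum_power2_sum_list:
  fixes f :: "'a \<Rightarrow> real"
  assumes "finite S" and f: "(\<Sum>r\<in>S. f r) = 0"
  shows "card S * (\<Sum>rs\<in>lists_of_length S K. (sum_list (map f rs))\<^sup>2) = K * card S ^ K * (\<Sum>r\<in>S. (f r)\<^sup>2)"
proof (induction K)
  case (Suc K)
  have "(\<Sum>rs\<in>lists_of_length S (Suc K). (sum_list (map f rs))\<^sup>2) =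
      (\<Sum>r\<in>S. \<Sum>rs\<in>lists_of_length S K. (f r)\<^sup>2 + (sum_list (map f rs))\<^sup>2 + 2 * f r * sum_list (map f rs))"
    by (simp add: sum_lists_of_length_Suc power2_sum)
  also have "\<dots> = card S ^ K * (\<Sum>r\<in>S. (f r)\<^sup>2) + card S * (\<Sum>rs\<in>lists_of_length S K. (sum_list (map f rs))\<^sup>2)"
    by (simp add: sum.distrib sum_sum_list_eq_0[OF f] card_lists_of_length[OF assms(1)] flip: sum_distrib_left)
  finally show ?case
    using Suc by (simp add: algebra_simps)
qed simp

definition mean :: "'a set \<Rightarrow> ('a \<Rightarrow> real) \<Rightarrow> real" where
  "mean S f = (\<Sum>x\<in>S. f x) / card S"

definition rect_mean :: "'a set \<Rightarrow> 'b set \<Rightarrow> ('a \<Rightarrow> 'b \<Rightarrow> real) \<Rightarrow> real" where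
  "rect_mean A B h = (\<Sum>x\<in>A. \<Sum>y\<in>B. h x y) / (real (card A) * real (card B))"

lemma exists_le_mean:
  assumes "finite S" "S \<noteq> {}"
  shows "\<exists>x\<in>S. f x \<le> mean S f"
proof (rule ccontr)
  assume "\<not> ?thesis"
  then have "(\<Sum>x\<in>S. mean S f) < (\<Sum>x\<in>S. f x)"
    using assms by (intro sum_strict_mono) auto
  then show False
    using assms by (simp add: mean_def)
qed

lemma exp_le_quadratic:
  fixes c :: real
  assumes "\<bar>c\<bar> \<le> 1"
  shows "exp c \<le> 1 + c + c\<^sup>2"
proof (cases "0 \<le> c")
  case True
  then show ?thesis using exp_bound[of c] assms by simp
next
  case False
  define u where "u = - c"
  have u: "0 < u" using False by (simp add: u_def)
  \<comment> \<open>The product is 1 + u ^ 3. Together with 1 + u \<le> exp u it bounds exp (-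
    u).\<close>
  have "1 \<le> (1 - u + u\<^sup>2) * (1 + u)"
    using u by (simp add: algebra_simps power2_eq_square)
  also have "\<dots> \<le> (1 - u + u\<^sup>2) * exp u"
    using exp_ge_add_one_self[of u] sum_squares_ge_zero[of "u - 1 / 2" 0]
    by (intro mult_left_mono) (auto simp: power2_eq_square algebra_simps)
  finally show ?thesis
    using u_def by (simp add: exp_minus field_simps)
qed

section \<open>Typical fibers of dense sets\<close>

text \<open>Abstracts \<open>m\<close> independent coordinates, each uniform on \<open>V\<close>, of
  a uniform element of \<open>S\<close>. Independence is a product formula for test functions, so
  \<open>S\<close> need not itself be the product of the coordinate ranges: later its elements carry
  the lists of all levels, while only the strings of one level are the coordinates.\<close>

locale coordinates =
  fixes S :: "'x set" and V :: "'v set" and m :: nat and coord :: "nat \<Rightarrow> 'x \<Rightarrow> 'v"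
  assumes finite_S: "finite S" and S_nonempty: "S \<noteq> {}"
    and finite_V: "finite V" and V_nonempty: "V \<noteq> {}" and m_pos: "0 < m"
    and coord_in: "\<And>l x. l < m \<Longrightarrow> x \<in> S \<Longrightarrow> coord l x \<in> V"
    and independent: "\<And>\<psi> :: nat \<Rightarrow> 'v \<Rightarrow> real.
      (\<Sum>x\<in>S. \<Prod>l<m. \<psi> l (coord l x)) / card S = (\<Prod>l<m. (\<Sum>a\<in>V. \<psi> l a) / card V)"
begin

definition fiber :: "'x set \<Rightarrow> nat \<Rightarrow> 'v \<Rightarrow> 'x set" where
  "fiber M l a = {x \<in> M. coord l x = a}"

definition atypical :: "real \<Rightarrow> 'x set \<Rightarrow> (nat \<times> 'v) set" where
  "atypical \<epsilon> M = {(l, a) \<in> {..<m} \<times> V.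
     \<not> ((1 - \<epsilon>) * real (card M) \<le> real (card V) * real (card (fiber M l a)) \<and> real (card V) * real (card (fiber M l a)) \<le> (1 + \<epsilon>) * real (card M))}"

lemma card_V_pos: "0 < card V"
  using finite_V V_nonempty by (simp add: card_gt_0_iff)

lemma card_S_pos: "0 < card S"
  using finite_S S_nonempty by (simp add: card_gt_0_iff)

text \<open>Independence turns the moment into a product of single-coordinate averages 1 + (exp c -
  1) * card (Bad l) / card V, and 1 + t \<le> exp t is applied to each factor.\<close>

lemma exp_moment_le:
  assumes Bad: "\<And>l. l < m \<Longrightarrow> Bad l \<subseteq> V"
  shows "(\<Sum>x\<in>S. exp (c * (\<Sum>l<m. of_bool (coord l x \<in> Bad l)))) / card S
    \<le> exp ((exp c - 1) * ((\<Sum>l<m. real (card (Bad l))) / card V))"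
proof -
  have "(\<Sum>x\<in>S. exp (c * (\<Sum>l<m. of_bool (coord l x \<in> Bad l)))) / card S =
      (\<Sum>x\<in>S. \<Prod>l<m. exp (c * of_bool (coord l x \<in> Bad l))) / card S"
    by (simp only: sum_distrib_left exp_sum finite_lessThan)
  also have "\<dots> = (\<Prod>l<m. (\<Sum>a\<in>V. exp (c * of_bool (a \<in> Bad l))) / card V)"
    by (rule independent)
  also have "\<dots> \<le> (\<Prod>l<m. exp ((exp c - 1) * card (Bad l) / card V))"
  proof (intro prod_mono conjI)
    fix l assume "l \<in> {..<m}"
    then have "Bad l \<subseteq> V" using Bad by simp
    have "(\<Sum>a\<in>V. exp (c * of_bool (a \<in> Bad l))) = (\<Sum>a\<in>V. 1 + (exp c - 1) * of_bool (a \<in> Bad l))"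
      by (rule sum.cong) auto
    also have "\<dots> = card V + (exp c - 1) * card (Bad l)"
      using \<open>Bad l \<subseteq> V\<close> finite_V
      by (simp add: sum.distrib of_bool_def sum.If_cases Int_absorb1 flip: sum_distrib_left)
    finally have "(\<Sum>a\<in>V. exp (c * of_bool (a \<in> Bad l))) / card V = 1 + (exp c - 1) * card (Bad l) / card V"
      using card_V_pos by (simp add: add_divide_distrib)
    then show "(\<Sum>a\<in>V. exp (c * of_bool (a \<in> Bad l))) / card V \<le> exp ((exp c - 1) * card (Bad l) / card V)"
      by (metis exp_ge_add_one_self)
  qed (auto intro!: divide_nonneg_nonneg sum_nonneg)
  also have "\<dots> = exp ((exp c - 1) * ((\<Sum>l<m. real (card (Bad l))) / card V))"
    by (simp add: sum_divide_distrib sum_distrib_left flip: exp_sum)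
  finally show ?thesis .
qed

text \<open>Passing to a subset of density \<open>2 ^ -d\<close> costs a factor \<open>2 ^ d\<close> in an exponential moment.\<close>

lemma exp_tilt:
  assumes "M \<subseteq> S" "M \<noteq> {}" and d: "card S \<le> 2 ^ d * card M"
    and Bad: "\<And>l. l < m \<Longrightarrow> Bad l \<subseteq> V"
  shows "c * ((\<Sum>l<m. \<Sum>a\<in>Bad l. real (card (fiber M l a))) / card M)
    \<le> d + (exp c - 1) * ((\<Sum>l<m. real (card (Bad l))) / card V)" (is "_ * ?z \<le> _ + ?E")
proof -
  define Z where "Z x = (\<Sum>l<m. of_bool (coord l x \<in> Bad l) :: real)" for x
  have fin_M: "finite M" using assms(1) finite_S finite_subset by blast
  then have M_pos: "0 < card M" using assms(2) by (simp add: card_gt_0_iff)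
  have card_Bad: "(\<Sum>a\<in>Bad l. real (card (fiber M l a))) = (\<Sum>x\<in>M. of_bool (coord l x \<in> Bad l))"
    if "l < m" for l
  proof -
    have "finite (Bad l)" using Bad[OF that] finite_V finite_subset by blast
    have "(\<Sum>a\<in>Bad l. real (card (fiber M l a))) = (\<Sum>a\<in>Bad l. \<Sum>x\<in>M. of_bool (coord l x = a))"
      using fin_M by (simp add: fiber_def of_bool_def sum.If_cases Int_def)
    also have "\<dots> = (\<Sum>x\<in>M. \<Sum>a\<in>Bad l. of_bool (coord l x = a))"
      by (rule sum.swap)
    also have "\<dots> = (\<Sum>x\<in>M. of_bool (coord l x \<in> Bad l))"
      using \<open>finite (Bad l)\<close> by (simp add: of_bool_def)
    finally show ?thesis .
  qed
  have sum_Z: "(\<Sum>x\<in>M. Z x) = ?z * card M"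
  proof -
    have "(\<Sum>x\<in>M. Z x) = (\<Sum>l<m. \<Sum>x\<in>M. of_bool (coord l x \<in> Bad l))"
      unfolding Z_def by (rule sum.swap)
    then show ?thesis using M_pos by (simp add: card_Bad)
  qed
  \<comment> \<open>Jensen's inequality by hand: exp is bounded below by its tangent at
    \<open>c * ?z\<close>, and the linear term cancels because \<open>?z\<close> is the mean of
    \<open>Z\<close> over \<open>M\<close>.\<close>
  have "exp (c * ?z) * card M = (\<Sum>x\<in>M. exp (c * ?z) * (1 + (c * Z x - c * ?z)))"
    using sum_Z M_pos
    by (simp add: sum.distrib sum_subtractf flip: sum_distrib_left) 
  also have "\<dots> \<le> (\<Sum>x\<in>M. exp (c * Z x))"
  proof (rule sum_mono)
    fix x
    have "exp (c * ?z) * (1 + (c * Z x - c * ?z)) \<le> exp (c * ?z) * exp (c * Z x - c * ?z)"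
      by (intro mult_left_mono exp_ge_add_one_self) auto
    then show "exp (c * ?z) * (1 + (c * Z x - c * ?z)) \<le> exp (c * Z x)"
      by (simp flip: exp_add)
  qed
  also have "\<dots> \<le> (\<Sum>x\<in>S. exp (c * Z x))"
    using assms(1) finite_S by (intro sum_mono2) auto
  also have "\<dots> \<le> card S * exp ?E"
    using exp_moment_le[of Bad c, OF Bad] card_S_pos by (simp add: Z_def field_simps)
  also have "\<dots> \<le> (2 ^ d * card M) * exp ?E"
    using d by (intro mult_right_mono) (simp_all flip: of_nat_le_iff[where ?'a = real])
  finally have "exp (c * ?z) \<le> 2 ^ d * exp ?E"
    using M_pos by (simp add: field_simps)
  also have "(2::real) ^ d \<le> exp 1 ^ d"
    using exp_ge_add_one_self[of 1] by (intro power_mono) auto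
  then have "2 ^ d * exp ?E \<le> exp (d + ?E)"
    by (simp add: exp_add flip: exp_of_nat_mult)
  finally show ?thesis by simp
qed

text \<open>The tilted moment bound is applied with c = - \<epsilon> / 2 to the undersized fibers
  and with c = \<epsilon> / 2 to the oversized ones. The quadratic term of exp consumes half of the
  gain \<epsilon> ^ 2 / 2, so each kind contributes at most 4 * d / \<epsilon> ^ 2 times
  \<open>card V\<close>. As there are m * card V pairs in all, the atypical fraction is small once m
  is large against d / \<epsilon> ^ 2.\<close>

lemma few_atypical:
  assumes "M \<subseteq> S" "M \<noteq> {}" and d: "card S \<le> 2 ^ d * card M" and \<epsilon>: "0 < \<epsilon>" "\<epsilon> \<le> 1"
  shows "card (atypical \<epsilon> M) \<le> 8 * d / \<epsilon>\<^sup>2 * card V"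
proof -
  define lo where "lo l = {a \<in> V. real (card V) * real (card (fiber M l a)) < (1 - \<epsilon>) * real (card M)}" for l
  define hi where "hi l = {a \<in> V. real (card V) * real (card (fiber M l a)) > (1 + \<epsilon>) * real (card M)}" for l
  have fin_M: "finite M" using assms(1) finite_S finite_subset by blast
  then have M_pos: "0 < card M" using assms(2) by (simp add: card_gt_0_iff)
  define b where "b B = (\<Sum>l<m. real (card (B l))) / card V" for B :: "nat \<Rightarrow> 'v set"
  define z where "z B = (\<Sum>l<m. \<Sum>a\<in>B l. real (card (fiber M l a))) / card M" for B
  have b_nonneg: "0 \<le> b B" for B :: "nat \<Rightarrow> 'v set"
    by (auto simp: b_def intro!: divide_nonneg_nonneg sum_nonneg)
  have "(\<Sum>a\<in>lo l. real (card (fiber M l a))) \<le> card (lo l) * ((1 - \<epsilon>) * real (card M) / card V)" for l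
    using card_V_pos by (intro sum_bounded_above) (auto simp: lo_def field_simps)
  then have "(\<Sum>l<m. \<Sum>a\<in>lo l. real (card (fiber M l a))) \<le> (\<Sum>l<m. real (card (lo l))) * ((1 - \<epsilon>) * real (card M) / card V)"
    unfolding sum_distrib_right by (rule sum_mono)
  then have z_lo: "z lo \<le> (1 - \<epsilon>) * b lo"
    using M_pos by (simp add: z_def b_def field_simps)
  have "(\<Sum>a\<in>hi l. real (card (fiber M l a))) \<ge> card (hi l) * ((1 + \<epsilon>) * real (card M) / card V)" for l
    using card_V_pos by (intro sum_bounded_below) (auto simp: hi_def field_simps)
  then have "(\<Sum>l<m. \<Sum>a\<in>hi l. real (card (fiber M l a))) \<ge> (\<Sum>l<m. real (card (hi l))) * ((1 + \<epsilon>) * real (card M) / card V)"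
    unfolding sum_distrib_right by (rule sum_mono)
  then have z_hi: "z hi \<ge> (1 + \<epsilon>) * b hi"
    using M_pos by (simp add: z_def b_def field_simps)
  have "(- \<epsilon> / 2) * ((1 - \<epsilon>) * b lo) \<le> (- \<epsilon> / 2) * z lo"
    using z_lo \<epsilon> by (intro mult_left_mono_neg) auto
  also have "\<dots> \<le> d + (exp (- \<epsilon> / 2) - 1) * b lo"
    unfolding z_def b_def by (rule exp_tilt[OF assms(1-3)]) (auto simp: lo_def)
  also have "\<dots> \<le> d + (- \<epsilon> / 2 + (\<epsilon> / 2)\<^sup>2) * b lo"
    using exp_le_quadratic[of "- \<epsilon> / 2"] \<epsilon> b_nonneg[of lo] by (intro add_left_mono mult_right_mono) auto
  finally have lo: "\<epsilon>\<^sup>2 * b lo \<le> 4 * d"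
    by (simp add: algebra_simps power2_eq_square)
  have "(\<epsilon> / 2) * ((1 + \<epsilon>) * b hi) \<le> (\<epsilon> / 2) * z hi"
    using z_hi \<epsilon> by (intro mult_left_mono) auto
  also have "\<dots> \<le> d + (exp (\<epsilon> / 2) - 1) * b hi"
    unfolding z_def b_def by (rule exp_tilt[OF assms(1-3)]) (auto simp: hi_def)
  also have "\<dots> \<le> d + (\<epsilon> / 2 + (\<epsilon> / 2)\<^sup>2) * b hi"
    using exp_le_quadratic[of "\<epsilon> / 2"] \<epsilon> b_nonneg[of hi] by (intro add_left_mono mult_right_mono) auto
  finally have hi: "\<epsilon>\<^sup>2 * b hi \<le> 4 * d"
    by (simp add: algebra_simps power2_eq_square)
  have "atypical \<epsilon> M \<subseteq> (SIGMA l:{..<m}. lo l \<union> hi l)"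
    by (auto simp: atypical_def lo_def hi_def)
  then have "card (atypical \<epsilon> M) \<le> card (SIGMA l:{..<m}. lo l \<union> hi l)"
    by (intro card_mono) (auto simp: lo_def hi_def finite_V)
  also have "\<dots> = (\<Sum>l<m. card (lo l \<union> hi l))"
    by (simp add: lo_def hi_def finite_V)
  also have "\<dots> \<le> (\<Sum>l<m. card (lo l) + card (hi l))"
    by (intro sum_mono card_Un_le)
  finally have "real (card (atypical \<epsilon> M)) \<le> real (\<Sum>l<m. card (lo l) + card (hi l))"
    by (rule of_nat_mono)
  also have "\<dots> = (\<Sum>l<m. real (card (lo l))) + (\<Sum>l<m. real (card (hi l)))"
    by (simp add: sum.distrib)
  also have "\<dots> = (b lo + b hi) * card V"
    using card_V_pos by (simp add: b_def field_simps)
  also have "\<dots> \<le> (8 * d / \<epsilon>\<^sup>2) * card V"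
    using lo hi \<epsilon> by (intro mult_right_mono) (auto simp: field_simps)
  finally show ?thesis by simp
qed

end

section \<open>Leaves of protocols\<close>

text \<open>The leaves are combinatorial rectangles that partition \<open>A \<times> B\<close>. The
  partition is expressed by the sum identity for every \<open>h\<close>, over a list, so that
  disjointness and distinctness of leaves need no separate treatment. Leaves that no input reaches
  are dropped.\<close>

lemma protocol_leaves:
  assumes "finite A" "finite B" "\<And>x y. x \<in> A \<Longrightarrow> y \<in> B \<Longrightarrow> bits_communicated P x y \<le> D"
  obtains Ls where "length Ls \<le> 2 ^ D"
    "\<And>A' B' z. (A', B', z) \<in> set Ls \<Longrightarrow> A' \<subseteq> A \<and> B' \<subseteq> B \<and> A' \<noteq> {} \<and> B' \<noteq> {}"
    "\<And>A' B' z x y. (A', B', z) \<in> set Ls \<Longrightarrow> x \<in> A' \<Longrightarrow> y \<in> B' \<Longrightarrow> run_protocol P x y = z"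
    "\<And>h :: 'a \<Rightarrow> 'b \<Rightarrow> real. (\<Sum>x\<in>A. \<Sum>y\<in>B. h x y) = (\<Sum>(A', B', z)\<leftarrow>Ls. \<Sum>x\<in>A'. \<Sum>y\<in>B'. h x y)"
proof -
  have "\<exists>Ls. length Ls \<le> 2 ^ D \<and>
    (\<forall>(A', B', z)\<in>set Ls. A' \<subseteq> A \<and> B' \<subseteq> B \<and> A' \<noteq> {} \<and> B' \<noteq> {} \<and> (\<forall>x\<in>A'. \<forall>y\<in>B'. run_protocol P x y = z)) \<and>
    (\<forall>h :: 'a \<Rightarrow> 'b \<Rightarrow> real. (\<Sum>x\<in>A. \<Sum>y\<in>B. h x y) = (\<Sum>(A', B', z)\<leftarrow>Ls. \<Sum>x\<in>A'. \<Sum>y\<in>B'. h x y))"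
    (is "\<exists>Ls. ?leaves P A B D Ls") using assms
  proof (induction P arbitrary: A B D)
    case (Output z)
    show ?case
    proof (cases "A = {} \<or> B = {}")
      case True
      then show ?thesis by (intro exI[of _ "[]"]) auto
    next
      case False
      then show ?thesis by (intro exI[of _ "[(A, B, z)]"]) auto
    qed
  next
    case (Alice_Sends f P Q)
    show ?case
    proof (cases "A = {} \<or> B = {}")
      case True
      then show ?thesis by (intro exI[of _ "[]"]) auto
    next
      case False
      \<comment> \<open>A nonempty rectangle supplies an input pair that sends a bit here, so
        \<open>D\<close> cannot be 0. For an empty rectangle the empty list of leaves
        suffices.\<close>
      then obtain D' where D: "D = Suc D'"
        using Alice_Sends.prems(3) by (cases D) fastforce+
      let ?A1 = "{x \<in> A. f x}" and ?A2 = "{x \<in> A. \<not> f x}"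
      obtain Ls1 where 1: "?leaves P ?A1 B D' Ls1"
        using Alice_Sends.IH(1)[of ?A1 B D'] Alice_Sends.prems D by fastforce
      obtain Ls2 where 2: "?leaves Q ?A2 B D' Ls2"
        using Alice_Sends.IH(2)[of ?A2 B D'] Alice_Sends.prems D by fastforce
      have split: "(\<Sum>x\<in>A. g x) = (\<Sum>x\<in>?A1. g x) + (\<Sum>x\<in>?A2. g x)" for g :: "'a \<Rightarrow> real"
        using Alice_Sends.prems(1) by (subst sum.union_disjoint[symmetric]) (auto intro: sum.cong)
      have "?leaves (Alice_Sends f P Q) A B D (Ls1 @ Ls2)"
        using 1 2 D by (fastforce simp: split)
      then show ?thesis by blast
    qed
  next
    case (Bob_Sends g P Q)
    show ?case
    proof (cases "A = {} \<or> B = {}")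
      case True
      then show ?thesis by (intro exI[of _ "[]"]) auto
    next
      case False
      then obtain D' where D: "D = Suc D'"
        using Bob_Sends.prems(3) by (cases D) fastforce+
      let ?B1 = "{y \<in> B. g y}" and ?B2 = "{y \<in> B. \<not> g y}"
      obtain Ls1 where 1: "?leaves P A ?B1 D' Ls1"
        using Bob_Sends.IH(1)[of A ?B1 D'] Bob_Sends.prems D by fastforce
      obtain Ls2 where 2: "?leaves Q A ?B2 D' Ls2"
        using Bob_Sends.IH(2)[of A ?B2 D'] Bob_Sends.prems D by fastforce
      have split: "(\<Sum>y\<in>B. h y) = (\<Sum>y\<in>?B1. h y) + (\<Sum>y\<in>?B2. h y)" for h :: "'b \<Rightarrow> real"
        using Bob_Sends.prems(2) by (subst sum.union_disjoint[symmetric]) (auto intro: sum.cong)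
      have "?leaves (Bob_Sends g P Q) A B D (Ls1 @ Ls2)"
        using 1 2 D by (fastforce simp: split sum.distrib)
      then show ?thesis by blast
    qed
  qed
  then show ?thesis
    using that by (fastforce)
qed

primrec bind_protocol :: "('a, 'b, 'o) protocol \<Rightarrow> ('o \<Rightarrow> ('a, 'b, 'p) protocol) \<Rightarrow> ('a, 'b, 'p) protocol" where
  "bind_protocol (Output z) k = k z"
| "bind_protocol (Alice_Sends f P Q) k = Alice_Sends f (bind_protocol P k) (bind_protocol Q k)"
| "bind_protocol (Bob_Sends g P Q) k = Bob_Sends g (bind_protocol P k) (bind_protocol Q k)"

lemma run_bind_protocol [simp]:
  "run_protocol (bind_protocol P k) x y = run_protocol (k (run_protocol P x y)) x y"
  by (induction P) auto

lemma bits_bind_protocol [simp]: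
  "bits_communicated (bind_protocol P k) x y =
    bits_communicated P x y + bits_communicated (k (run_protocol P x y)) x y"
  by (induction P) auto

text \<open>Joint runs serve twice: with many seeds of one protocol to freeze a profile, and with
  two seeds to observe a collision of outputs.\<close>

primrec run_all :: "('a, 'b, 'o) protocol list \<Rightarrow> ('a, 'b, 'o list) protocol" where
  "run_all [] = Output []"
| "run_all (P # Ps) = bind_protocol P (\<lambda>z. bind_protocol (run_all Ps) (\<lambda>zs. Output (z # zs)))"

lemma run_run_all [simp]: "run_protocol (run_all Ps) x y = map (\<lambda>P. run_protocol P x y) Ps"
  by (induction Ps) auto

lemma bits_run_all [simp]: "bits_communicated (run_all Ps) x y = (\<Sum>P\<leftarrow>Ps. bits_communicated P x y)"
  by (induction Ps) auto

text \<open>The leaves carrying less than a fraction \<open>\<eta>\<close> of the average mass have total mass below \<open>\<eta>\<close>.\<close>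

lemma good_leaf:
  assumes "finite A" "finite B" "A \<noteq> {}" "B \<noteq> {}"
    and bits: "\<And>x y. x \<in> A \<Longrightarrow> y \<in> B \<Longrightarrow> bits_communicated P x y \<le> D"
    and h: "\<And>x y. x \<in> A \<Longrightarrow> y \<in> B \<Longrightarrow> 0 \<le> h x y"
    and \<tau>: "rect_mean A B h \<le> \<tau>" "0 < \<tau>" and \<eta>: "0 < \<eta>" "\<eta> < 1"
  obtains A' B' z where "A' \<subseteq> A" "B' \<subseteq> B" "A' \<noteq> {}" "B' \<noteq> {}"
    "\<And>x y. x \<in> A' \<Longrightarrow> y \<in> B' \<Longrightarrow> run_protocol P x y = z"
    "real (card A') * real (card B') \<ge> \<eta> / 2 ^ D * (real (card A) * real (card B))"
    "rect_mean A' B' h \<le> \<tau> / (1 - \<eta>)"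
proof -
  obtain Ls where Ls: "length Ls \<le> 2 ^ D"
    "\<And>A' B' z. (A', B', z) \<in> set Ls \<Longrightarrow> A' \<subseteq> A \<and> B' \<subseteq> B \<and> A' \<noteq> {} \<and> B' \<noteq> {}"
    "\<And>A' B' z x y. (A', B', z) \<in> set Ls \<Longrightarrow> x \<in> A' \<Longrightarrow> y \<in> B' \<Longrightarrow> run_protocol P x y = z"
    "\<And>h :: 'a \<Rightarrow> 'b \<Rightarrow> real. (\<Sum>x\<in>A. \<Sum>y\<in>B. h x y) = (\<Sum>(A', B', z)\<leftarrow>Ls. \<Sum>x\<in>A'. \<Sum>y\<in>B'. h x y)"
    using protocol_leaves[OF assms(1,2) bits] by blast
  define N where "N = real (card A) * real (card B)"
  have N_pos: "0 < N" using assms(1-4) by (simp add: N_def card_gt_0_iff)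
  \<comment> \<open>A single inequality gives both conclusions: its right side must be nonnegative,
    so the leaf is large, and dropping the subtracted term bounds the mean of \<open>h\<close>. If
    it failed at every leaf, summing over the at most \<open>2 ^ D\<close> leaves would give total
    mass above \<open>\<tau> * N\<close>.\<close>
  have "\<exists>(A', B', z)\<in>set Ls. (\<Sum>x\<in>A'. \<Sum>y\<in>B'. h x y) \<le>
      \<tau> / (1 - \<eta>) * (real (card A') * real (card B') - \<eta> / 2 ^ D * N)"
  proof (rule ccontr)
    assume neg: "\<not> ?thesis"
    have "Ls \<noteq> []"
    proof
      assume "Ls = []"
      then have "(\<Sum>x\<in>A. \<Sum>y\<in>B. 1::real) = 0" by (simp only: Ls(4)) simp
      then show False using N_pos unfolding N_def by auto
    qed
    then have "(\<Sum>(A', B', z)\<leftarrow>Ls. \<tau> / (1 - \<eta>) * (real (card A') * real (card B') - \<eta> / 2 ^ D * N))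
        < (\<Sum>(A', B', z)\<leftarrow>Ls. \<Sum>x\<in>A'. \<Sum>y\<in>B'. h x y)"
      using neg by (intro sum_list_strict_mono) (auto simp: not_le)
    also have "\<dots> \<le> \<tau> * N"
      using \<tau>(1) N_pos by (simp add: rect_mean_def N_def field_simps flip: Ls(4))
    finally have lt: "(\<Sum>(A', B', z)\<leftarrow>Ls. \<tau> / (1 - \<eta>) * (real (card A') * real (card B') - \<eta> / 2 ^ D * N)) < \<tau> * N" .
    have card_sum: "(\<Sum>(A', B', z)\<leftarrow>Ls. real (card A') * real (card B')) = N"
      using Ls(4)[of "\<lambda>_ _. 1"] by (simp add: N_def split_def)
    have "(\<Sum>(A', B', z)\<leftarrow>Ls. c * (real (card A') * real (card B') - e))
        = c * ((\<Sum>(A', B', z)\<leftarrow>Ls. real (card A') * real (card B')) - length Ls * e)" for c e :: real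
      by (induction Ls) (auto simp: algebra_simps)
    then have "(\<Sum>(A', B', z)\<leftarrow>Ls. \<tau> / (1 - \<eta>) * (real (card A') * real (card B') - \<eta> / 2 ^ D * N))
        = \<tau> / (1 - \<eta>) * ((\<Sum>(A', B', z)\<leftarrow>Ls. real (card A') * real (card B')) - length Ls * (\<eta> / 2 ^ D * N))" .
    also have "\<dots> \<ge> \<tau> / (1 - \<eta>) * (N - \<eta> * N)"
    proof -
      have "real (length Ls) \<le> 2 ^ D" using of_nat_mono[OF Ls(1), where 'a = real] by simp
      then have "length Ls * (\<eta> / 2 ^ D * N) \<le> 2 ^ D * (\<eta> / 2 ^ D * N)"
        using \<eta> N_pos by (intro mult_right_mono) auto
      then show ?thesis
        unfolding card_sum using \<tau> \<eta> by (intro mult_left_mono) auto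
    qed
    also have "\<tau> / (1 - \<eta>) * (N - \<eta> * N) = \<tau> * N"
      using \<eta> by (simp add: field_simps)
    finally show False using lt by simp
  qed
  then obtain A' B' z where L: "(A', B', z) \<in> set Ls" and
    le: "(\<Sum>x\<in>A'. \<Sum>y\<in>B'. h x y) \<le> \<tau> / (1 - \<eta>) * (real (card A') * real (card B') - \<eta> / 2 ^ D * N)"
    by blast
  note sub = Ls(2)[OF L]
  have "0 \<le> (\<Sum>x\<in>A'. \<Sum>y\<in>B'. h x y)"
    using h sub by (intro sum_nonneg) auto
  then have "0 \<le> \<tau> / (1 - \<eta>) * (real (card A') * real (card B') - \<eta> / 2 ^ D * N)"
    using le by simp
  then have big: "\<eta> / 2 ^ D * N \<le> real (card A') * real (card B')"
    using \<tau> \<eta> by (simp add: zero_le_mult_iff zero_le_divide_iff)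
  have "finite A'" "finite B'" using sub assms(1,2) finite_subset by blast+
  then have pos: "0 < real (card A') * real (card B')" using sub by (simp add: card_gt_0_iff)
  have "(\<Sum>x\<in>A'. \<Sum>y\<in>B'. h x y) \<le> \<tau> / (1 - \<eta>) * (real (card A') * real (card B'))"
    using \<tau> \<eta> N_pos by (intro order_trans[OF le] mult_left_mono) auto
  then have "rect_mean A' B' h \<le> \<tau> / (1 - \<eta>)"
    using pos by (simp add: rect_mean_def pos_divide_le_eq)
  then show ?thesis
    using that[of A' B' z] sub big Ls(3)[OF L] by (simp add: N_def)
qed

section \<open>Planting a collision\<close>

lemma sum_sum_list_swap:
  fixes f :: "'a \<Rightarrow> 'b \<Rightarrow> real"
  shows "(\<Sum>x\<in>A. \<Sum>z\<leftarrow>zs. f x z) = (\<Sum>z\<leftarrow>zs. \<Sum>x\<in>A. f x z)"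
  by (induction zs) (auto simp: sum.distrib)

context coordinates
begin

definition typical_triples :: "real \<Rightarrow> ('v \<Rightarrow> 'v) \<Rightarrow> 'x set \<Rightarrow> 'x set \<Rightarrow> (nat \<times> nat \<times> 'v) set" where
  "typical_triples \<epsilon> \<tau> A B =
     {(l, l', a) \<in> {..<m} \<times> {..<m} \<times> V. (l, a) \<notin> atypical \<epsilon> A \<and> (l', \<tau> a) \<notin> atypical \<epsilon> B}"

lemma finite_atypical: "finite (atypical \<epsilon> M)"
  by (rule finite_subset[of _ "{..<m} \<times> V"]) (auto simp: atypical_def finite_V)

lemma finite_typical_triples: "finite (typical_triples \<epsilon> \<tau> A B)"
  by (rule finite_subset[of _ "{..<m} \<times> {..<m} \<times> V"]) (auto simp: typical_triples_def finite_V)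

lemma sum_fiber:
  fixes g :: "'x \<Rightarrow> real"
  assumes "finite M"
  shows "(\<Sum>x\<in>fiber M l a. g x) = (\<Sum>x\<in>M. of_bool (coord l x = a) * g x)"
  unfolding fiber_def sum.inter_filter[OF assms] by (intro sum.cong) auto

lemma card_typical_triples_le: "card (typical_triples \<epsilon> \<tau> A B) \<le> m\<^sup>2 * card V"
proof -
  have "card (typical_triples \<epsilon> \<tau> A B) \<le> card ({..<m} \<times> {..<m} \<times> V)"
    by (intro card_mono) (auto simp: typical_triples_def finite_V)
  then show ?thesis by (simp add: card_cartesian_product power2_eq_square)
qed

text \<open>Union bound over four kinds of failure. One atypical pair spoils at most
  \<open>m\<close> triples: a pair (l, a) leaves l' free, and a pair (l', \<tau> a) determines a by
  injectivity of \<open>\<tau>\<close> and leaves l free.\<close>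

lemma card_atypical_triples:
  fixes b :: real
  assumes \<tau>: "bij_betw \<tau> V V"
    and A: "card (atypical \<epsilon> A) \<le> b" and A': "card (atypical \<epsilon> A') \<le> b"
    and B: "card (atypical \<epsilon> B) \<le> b" and B': "card (atypical \<epsilon> B') \<le> b"
  shows "real m ^ 2 * card V - 4 * m * b \<le> card (typical_triples \<epsilon> \<tau> A B \<inter> typical_triples \<epsilon> \<tau> A' B')"
proof -
  let ?T = "{..<m} \<times> {..<m} \<times> V"
  let ?G = "typical_triples \<epsilon> \<tau> A B \<inter> typical_triples \<epsilon> \<tau> A' B'"
  define first where "first M = (\<lambda>((l, a), l'). (l, l', a)) ` (atypical \<epsilon> M \<times> {..<m})" for M
  define second where "second M = {(l, l', a) \<in> ?T. (l', \<tau> a) \<in> atypical \<epsilon> M}" for M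
  have fin: "finite ?T" by (simp add: finite_V)
  have first: "card (first M) \<le> m * card (atypical \<epsilon> M)" for M
    using card_image_le[of "atypical \<epsilon> M \<times> {..<m}"]
    by (simp add: first_def finite_atypical card_cartesian_product mult.commute)
  have second: "card (second M) \<le> m * card (atypical \<epsilon> M)" for M
  proof -
    have "inj_on (\<lambda>(l, l', a). (l, (l', \<tau> a))) (second M)"
      using \<tau> by (auto simp: inj_on_def second_def bij_betw_def)
    moreover have "(\<lambda>(l, l', a). (l, (l', \<tau> a))) ` second M \<subseteq> {..<m} \<times> atypical \<epsilon> M"
      by (auto simp: second_def)
    ultimately have "card (second M) \<le> card ({..<m} \<times> atypical \<epsilon> M)"
      by (rule card_inj_on_le) (simp add: finite_atypical)
    then show ?thesis by (simp add: card_cartesian_product)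
  qed
  have "?T \<subseteq> ?G \<union> (first A \<union> first A' \<union> (second B \<union> second B'))"
    by (fastforce simp: typical_triples_def first_def second_def image_iff)
  moreover have "finite (?G \<union> (first A \<union> first A' \<union> (second B \<union> second B')))"
    using fin by (auto simp: finite_typical_triples first_def finite_atypical second_def intro: finite_subset[OF _ fin])
  ultimately have "card ?T \<le> card (?G \<union> (first A \<union> first A' \<union> (second B \<union> second B')))"
    by (rule card_mono[rotated])
  also have "\<dots> \<le> card ?G + (card (first A) + card (first A') + (card (second B) + card (second B')))"
    using card_Un_le[of ?G "first A \<union> first A' \<union> (second B \<union> second B')"]
      card_Un_le[of "first A \<union> first A'" "second B \<union> second B'"]
      card_Un_le[of "first A" "first A'"] card_Un_le[of "second B" "second B'"] by linarith
  also have "\<dots> \<le> card ?G + m * (card (atypical \<epsilon> A) + card (atypical \<epsilon> A') + (card (atypical \<epsilon> B) + card (atypical \<epsilon> B')))"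
    using first[of A] first[of A'] second[of B] second[of B'] by (simp add: distrib_left)
  finally have "real (card ?T) \<le> card ?G + m * (real (card (atypical \<epsilon> A)) + real (card (atypical \<epsilon> A'))
      + (real (card (atypical \<epsilon> B)) + real (card (atypical \<epsilon> B'))))"
    by (metis of_nat_add of_nat_le_iff of_nat_mult)
  also have "\<dots> \<le> card ?G + m * (b + b + (b + b))"
    using assms by (intro add_left_mono mult_left_mono add_mono) auto
  finally show ?thesis
    by (simp add: card_cartesian_product power2_eq_square algebra_simps)
qed

lemma fiber_ratio:
  assumes "A' \<subseteq> A" "A \<subseteq> S" and \<epsilon>: "0 < \<epsilon>" "\<epsilon> < 1"
    and "l < m" "a \<in> V" "(l, a) \<notin> atypical \<epsilon> A" "(l, a) \<notin> atypical \<epsilon> A'"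
  shows "(1 - \<epsilon>) / (1 + \<epsilon>) * (card A' / card A) \<le> card (fiber A' l a) / card (fiber A l a)"
proof (cases "A = {}")
  case True
  then show ?thesis by simp
next
  case False
  have "finite A" using assms(2) finite_S finite_subset by blast
  then have A_pos: "0 < card A" using False by (simp add: card_gt_0_iff)
  have lo: "(1 - \<epsilon>) * card A' \<le> card V * card (fiber A' l a)"
    and hi: "card V * card (fiber A l a) \<le> (1 + \<epsilon>) * card A"
    and lo_A: "(1 - \<epsilon>) * card A \<le> card V * card (fiber A l a)"
    using assms by (auto simp: atypical_def)
  have "0 < (1 - \<epsilon>) * card A" using A_pos \<epsilon> by simp
  then have pos: "0 < card V * real (card (fiber A l a))" using lo_A by simp
  have "(1 - \<epsilon>) / (1 + \<epsilon>) * (card A' / card A) = (1 - \<epsilon>) * card A' / ((1 + \<epsilon>) * card A)"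
    by simp
  also have "\<dots> \<le> card V * card (fiber A' l a) / (card V * card (fiber A l a))"
    using lo hi pos \<epsilon> A_pos by (intro frac_le) (auto intro: mult_nonneg_nonneg)
  also have "\<dots> = card (fiber A' l a) / card (fiber A l a)"
    using card_V_pos by simp
  finally show ?thesis .
qed

text \<open>If both sides of the subrectangle have relative density at least 2 ^ - e, then the bound
  on \<open>\<kappa>\<close> makes at most a fraction \<open>\<kappa>\<close> of the pairs atypical
  for each of the four sets. All but a fraction 4 * \<kappa> of the triples are then typical
  throughout, and on those the relative size shrinks at most by ((1 - \<epsilon>) / (1 +
  \<epsilon>)) ^ 2 \<ge> 1 - 4 * \<epsilon>. If a side is thinner, the relative size of the
  subrectangle is below 2 ^ - e, and the subtracted term makes the bound trivial.\<close>

lemma plant_rectangle: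
  fixes \<epsilon> \<kappa> :: real
  assumes sub: "A \<subseteq> S" "B \<subseteq> S" "A' \<subseteq> A" "B' \<subseteq> B" and ne: "A' \<noteq> {}" "B' \<noteq> {}"
    and \<tau>: "bij_betw \<tau> V V"
    and dA: "card S \<le> 2 ^ d * card A" and dB: "card S \<le> 2 ^ d * card B"
    and \<epsilon>: "0 < \<epsilon>" "\<epsilon> \<le> 1" and \<kappa>: "8 * (d + e) / \<epsilon>\<^sup>2 \<le> \<kappa> * m" "4 * \<kappa> + 4 * \<epsilon> < 1"
  shows "(\<Sum>(l, l', a)\<in>typical_triples \<epsilon> \<tau> A B.
      (real (card (fiber A' l a)) * real (card (fiber B' l' (\<tau> a)))) /
      (real (card (fiber A l a)) * real (card (fiber B l' (\<tau> a)))))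
    \<ge> real m ^ 2 * card V * ((1 - 4 * \<kappa> - 4 * \<epsilon>) *
      ((real (card A') * real (card B')) / (real (card A) * real (card B))) - 1 / 2 ^ e)"
    (is "(\<Sum>g\<in>?G. ?r g) \<ge> ?R")
proof -
  have ratio_nonneg: "0 \<le> ?r g" for g by (auto simp: split_def)
  have fin: "finite A" "finite B" "finite A'" "finite B'"
    using sub finite_S finite_subset by (metis subset_trans)+
  then have pos: "0 < card A'" "0 < card B'" "card A' \<le> card A" "card B' \<le> card B"
    using ne sub by (auto simp: card_gt_0_iff card_mono)
  then have pos': "0 < card A" "0 < card B" by linarith+
  define \<alpha> where "\<alpha> = card A' / card A"
  define \<beta> where "\<beta> = card B' / card B"
  have \<alpha>\<beta>: "0 < \<alpha>" "\<alpha> \<le> 1" "0 < \<beta>" "\<beta> \<le> 1"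
    using pos pos' by (auto simp: \<alpha>_def \<beta>_def)
  have R: "?R = real m ^ 2 * card V * ((1 - 4 * \<kappa> - 4 * \<epsilon>) * (\<alpha> * \<beta>) - 1 / 2 ^ e)"
    by (simp add: \<alpha>_def \<beta>_def)
  have "0 \<le> \<kappa> * m" using \<kappa>(1) by (rule order_trans[rotated]) simp
  then have \<kappa>_nonneg: "0 \<le> \<kappa>" using m_pos by (simp add: zero_le_mult_iff)
  show ?thesis
  proof (cases "card A \<le> 2 ^ e * card A' \<and> card B \<le> 2 ^ e * card B'")
    case False
    have "\<alpha> < 1 / 2 ^ e \<or> \<beta> < 1 / 2 ^ e"
    proof -
      have "\<alpha> < 1 / 2 ^ e" if "2 ^ e * card A' < card A"
        using of_nat_less_iff[where 'a = real, THEN iffD2, OF that] pos' by (simp add: \<alpha>_def field_simps)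
      moreover have "\<beta> < 1 / 2 ^ e" if "2 ^ e * card B' < card B"
        using of_nat_less_iff[where 'a = real, THEN iffD2, OF that] pos' by (simp add: \<beta>_def field_simps)
      ultimately show ?thesis using False by auto
    qed
    moreover have "\<alpha> * \<beta> \<le> \<alpha>" "\<alpha> * \<beta> \<le> \<beta>"
      using \<alpha>\<beta> by (simp_all add: mult_left_le mult_left_le_one_le)
    ultimately have "\<alpha> * \<beta> \<le> 1 / 2 ^ e" by linarith
    moreover have "(1 - 4 * \<kappa> - 4 * \<epsilon>) * (\<alpha> * \<beta>) \<le> \<alpha> * \<beta>"
      using \<alpha>\<beta> \<kappa>_nonneg \<epsilon> \<kappa>(2) by (intro mult_left_le_one_le) auto
    ultimately have "(1 - 4 * \<kappa> - 4 * \<epsilon>) * (\<alpha> * \<beta>) - 1 / 2 ^ e \<le> 0" by linarith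
    then have "?R \<le> 0"
      unfolding R by (intro mult_nonneg_nonpos) auto
    also have "0 \<le> (\<Sum>g\<in>?G. ?r g)"
      using ratio_nonneg by (intro sum_nonneg) auto
    finally show ?thesis .
  next
    case True
    define b where "b = 8 * real (d + e) / \<epsilon>\<^sup>2 * card V"
    have atyp: "card (atypical \<epsilon> M) \<le> b"
      if "M \<subseteq> S" "M \<noteq> {}" "card S \<le> 2 ^ (d + e) * card M" for M
      using few_atypical[OF that \<epsilon>] by (simp add: b_def)
    have dA': "card S \<le> 2 ^ (d + e) * card A'"
      using order_trans[OF dA mult_le_mono2[OF conjunct1[OF True]]] by (simp add: power_add algebra_simps)
    have dB': "card S \<le> 2 ^ (d + e) * card B'"
      using order_trans[OF dB mult_le_mono2[OF conjunct2[OF True]]] by (simp add: power_add algebra_simps)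
    have le: "2 ^ d * c \<le> 2 ^ (d + e) * c" for c :: nat
      by (intro mult_right_mono power_increasing) auto
    let ?G' = "?G \<inter> typical_triples \<epsilon> \<tau> A' B'"
    have "real m ^ 2 * card V - 4 * m * b \<le> card ?G'"
      by (intro card_atypical_triples \<tau> atyp)
        (use sub ne dA' dB' order_trans[OF dA le] order_trans[OF dB le] in auto)
    moreover have "4 * m * b \<le> 4 * \<kappa> * (real m ^ 2 * card V)"
    proof -
      have "4 * m * b = 4 * m * card V * (8 * real (d + e) / \<epsilon>\<^sup>2)" by (simp add: b_def)
      also have "\<dots> \<le> 4 * m * card V * (\<kappa> * m)" using \<kappa>(1) by (intro mult_left_mono) auto
      finally show ?thesis by (simp add: power2_eq_square algebra_simps)
    qed
    ultimately have card_G': "real m ^ 2 * card V * (1 - 4 * \<kappa>) \<le> card ?G'"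
      by (simp add: algebra_simps)
    define q where "q = (1 - \<epsilon>) / (1 + \<epsilon>)"
    have q: "1 - 2 * \<epsilon> \<le> q" "0 \<le> q" using \<epsilon> by (auto simp: q_def field_simps)
    have "1 - 4 * \<epsilon> \<le> (1 - 2 * \<epsilon>) * (1 - 2 * \<epsilon>)" by (simp add: algebra_simps)
    also have "\<dots> \<le> q * q" using q \<kappa>(2) \<kappa>_nonneg by (intro mult_mono) auto
    finally have qq: "1 - 4 * \<epsilon> \<le> q * q" .
    have term_ge: "q * q * (\<alpha> * \<beta>) \<le> ?r g" if "g \<in> ?G'" for g
    proof -
      obtain l l' a where g: "g = (l, l', a)" by (cases g) auto
      have mem: "l < m" "l' < m" "a \<in> V" "(l, a) \<notin> atypical \<epsilon> A" "(l', \<tau> a) \<notin> atypical \<epsilon> B"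
        "(l, a) \<notin> atypical \<epsilon> A'" "(l', \<tau> a) \<notin> atypical \<epsilon> B'"
        using that by (auto simp: g typical_triples_def)
      have "\<tau> a \<in> V" using \<tau> mem(3) by (auto simp: bij_betw_def)
      have "\<epsilon> < 1" using \<kappa>(2) \<kappa>_nonneg \<epsilon> by linarith
      have "(q * \<alpha>) * (q * \<beta>) \<le> (card (fiber A' l a) / card (fiber A l a)) *
          (card (fiber B' l' (\<tau> a)) / card (fiber B l' (\<tau> a)))"
        unfolding q_def \<alpha>_def \<beta>_def
        by (intro mult_mono fiber_ratio sub mem \<epsilon> \<open>\<epsilon> < 1\<close> \<open>\<tau> a \<in> V\<close>)
          (use \<epsilon> in auto)
      then show ?thesis by (simp add: g algebra_simps)
    qed
    have "?R \<le> real m ^ 2 * card V * ((1 - 4 * \<kappa> - 4 * \<epsilon>) * (\<alpha> * \<beta>))"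
      unfolding R by (intro mult_left_mono) auto
    also have "\<dots> \<le> real m ^ 2 * card V * ((1 - 4 * \<kappa>) * (q * q) * (\<alpha> * \<beta>))"
    proof (intro mult_left_mono mult_right_mono)
      have "1 - 4 * \<kappa> - 4 * \<epsilon> \<le> (1 - 4 * \<kappa>) * (1 - 4 * \<epsilon>)"
        using \<kappa>_nonneg \<epsilon> by (simp add: algebra_simps)
      also have "\<dots> \<le> (1 - 4 * \<kappa>) * (q * q)"
        using qq \<kappa>(2) \<epsilon> by (intro mult_left_mono) auto
      finally show "1 - 4 * \<kappa> - 4 * \<epsilon> \<le> (1 - 4 * \<kappa>) * (q * q)" .
    qed (use \<alpha>\<beta> in auto)
    also have "\<dots> = real m ^ 2 * card V * (1 - 4 * \<kappa>) * (q * q * (\<alpha> * \<beta>))"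
      by simp
    also have "\<dots> \<le> card ?G' * (q * q * (\<alpha> * \<beta>))"
      using card_G' q \<alpha>\<beta> by (intro mult_right_mono) auto
    also have "\<dots> \<le> (\<Sum>g\<in>?G'. ?r g)"
      using term_ge by (intro sum_bounded_below) auto
    also have "\<dots> \<le> (\<Sum>g\<in>?G. ?r g)"
      using ratio_nonneg by (intro sum_mono2 finite_typical_triples) auto
    finally show ?thesis .
  qed
qed

text \<open>Since \<open>\<phi>\<close> of the output is constant on each leaf, both means are
  weighted sums of relative sizes of leaf rectangles, to which the bound for one rectangle applies.
  Each of the at most \<open>2 ^ D\<close> leaves loses 1 / 2 ^ e, as \<open>\<phi>\<close> is at
  most 1.\<close>

lemma plant_run:
  fixes \<epsilon> \<kappa> :: real
  assumes sub: "A \<subseteq> S" "B \<subseteq> S" and ne: "A \<noteq> {}" "B \<noteq> {}"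
    and bits: "\<And>x y. x \<in> A \<Longrightarrow> y \<in> B \<Longrightarrow> bits_communicated P x y \<le> D"
    and \<phi>: "\<And>z. 0 \<le> \<phi> z \<and> \<phi> z \<le> (1::real)"
    and \<tau>: "bij_betw \<tau> V V"
    and dA: "card S \<le> 2 ^ d * card A" and dB: "card S \<le> 2 ^ d * card B"
    and \<epsilon>: "0 < \<epsilon>" "\<epsilon> \<le> 1" and \<kappa>: "8 * (d + e) / \<epsilon>\<^sup>2 \<le> \<kappa> * m" "4 * \<kappa> + 4 * \<epsilon> < 1"
  shows "(\<Sum>(l, l', a)\<in>typical_triples \<epsilon> \<tau> A B.
      rect_mean (fiber A l a) (fiber B l' (\<tau> a)) (\<lambda>x y. \<phi> (run_protocol P x y)))
    \<ge> real m ^ 2 * card V *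
      ((1 - 4 * \<kappa> - 4 * \<epsilon>) * rect_mean A B (\<lambda>x y. \<phi> (run_protocol P x y)) - 2 ^ D / 2 ^ e)"
proof -
  have fin: "finite A" "finite B" using sub finite_S finite_subset by blast+
  obtain Ls where Ls: "length Ls \<le> 2 ^ D"
    "\<And>A' B' z. (A', B', z) \<in> set Ls \<Longrightarrow> A' \<subseteq> A \<and> B' \<subseteq> B \<and> A' \<noteq> {} \<and> B' \<noteq> {}"
    "\<And>A' B' z x y. (A', B', z) \<in> set Ls \<Longrightarrow> x \<in> A' \<Longrightarrow> y \<in> B' \<Longrightarrow> run_protocol P x y = z"
    "\<And>h :: 'x \<Rightarrow> 'x \<Rightarrow> real. (\<Sum>x\<in>A. \<Sum>y\<in>B. h x y) = (\<Sum>(A', B', z)\<leftarrow>Ls. \<Sum>x\<in>A'. \<Sum>y\<in>B'. h x y)"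
    using protocol_leaves[OF fin bits] by blast
  let ?h = "\<lambda>x y. \<phi> (run_protocol P x y)"
  have mean_A: "rect_mean A B ?h =
      (\<Sum>(A', B', z)\<leftarrow>Ls. \<phi> z * (real (card A') * real (card B') / (real (card A) * real (card B))))"
  proof -
    have "(\<Sum>x\<in>A. \<Sum>y\<in>B. ?h x y) = (\<Sum>(A', B', z)\<leftarrow>Ls. \<phi> z * (real (card A') * real (card B')))"
      unfolding Ls(4) by (intro arg_cong[of _ _ sum_list] map_cong) (auto simp: Ls(3))
    then show ?thesis
      by (simp add: rect_mean_def split_def divide_inverse mult.assoc flip: sum_list_mult_const)
  qed
  have mean_fiber: "rect_mean (fiber A l a) (fiber B l' b) ?h =
      (\<Sum>(A', B', z)\<leftarrow>Ls. \<phi> z * (real (card (fiber A' l a)) * real (card (fiber B' l' b)) /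
        (real (card (fiber A l a)) * real (card (fiber B l' b)))))" for l l' a b
  proof -
    let ?i = "\<lambda>x y. of_bool (coord l x = a) * of_bool (coord l' y = b) :: real"
    have restrict: "(\<Sum>x\<in>fiber A1 l a. \<Sum>y\<in>fiber B1 l' b. h x y) = (\<Sum>x\<in>A1. \<Sum>y\<in>B1. ?i x y * h x y)"
      if "A1 \<subseteq> A" "B1 \<subseteq> B" for A1 B1 and h :: "'x \<Rightarrow> 'x \<Rightarrow> real"
    proof -
      have "finite A1" "finite B1" using that fin finite_subset by blast+
      then show ?thesis
        by (simp only: sum_fiber sum_distrib_left mult.assoc)
    qed
    have "(\<Sum>x\<in>fiber A l a. \<Sum>y\<in>fiber B l' b. ?h x y) =
        (\<Sum>(A', B', z)\<leftarrow>Ls. \<Sum>x\<in>A'. \<Sum>y\<in>B'. ?i x y * ?h x y)"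
      by (subst restrict) (auto simp only: Ls(4))
    also have "\<dots> = (\<Sum>(A', B', z)\<leftarrow>Ls. \<phi> z * (real (card (fiber A' l a)) * real (card (fiber B' l' b))))"
    proof (intro arg_cong[of _ _ sum_list] map_cong refl, clarify)
      fix A' B' z assume L: "(A', B', z) \<in> set Ls"
      have "(\<Sum>x\<in>A'. \<Sum>y\<in>B'. ?i x y * ?h x y) = (\<Sum>x\<in>A'. \<Sum>y\<in>B'. ?i x y * \<phi> z)"
        using Ls(3)[OF L] by (intro sum.cong) auto
      also have "\<dots> = (\<Sum>x\<in>fiber A' l a. \<Sum>y\<in>fiber B' l' b. \<phi> z)"
        using Ls(2)[OF L] by (subst restrict) auto
      finally show "(\<Sum>x\<in>A'. \<Sum>y\<in>B'. ?i x y * ?h x y) =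
          \<phi> z * (real (card (fiber A' l a)) * real (card (fiber B' l' b)))"
        by simp
    qed
    finally show ?thesis
      by (simp add: rect_mean_def split_def divide_inverse mult.assoc flip: sum_list_mult_const)
  qed
  let ?N = "real m ^ 2 * card V" and ?c = "1 - 4 * \<kappa> - 4 * \<epsilon>"
  have "?N * (?c * rect_mean A B ?h - 2 ^ D / 2 ^ e) \<le> ?N * (?c * rect_mean A B ?h - (\<Sum>L\<leftarrow>Ls. 1 / 2 ^ e))"
    using of_nat_mono[OF Ls(1), where 'a = real]
    by (intro mult_left_mono diff_left_mono) (auto simp: sum_list_triv divide_right_mono)
  also have "\<dots> = (\<Sum>(A', B', z)\<leftarrow>Ls. ?N * (?c * (\<phi> z * (real (card A') * real (card B') / (real (card A) * real (card B)))) - 1 / 2 ^ e))"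
    unfolding mean_A by (simp only: split_def flip: sum_list_const_mult sum_list_subtractf)
  also have "\<dots> \<le> (\<Sum>(A', B', z)\<leftarrow>Ls. \<Sum>(l, l', a)\<in>typical_triples \<epsilon> \<tau> A B.
      \<phi> z * (real (card (fiber A' l a)) * real (card (fiber B' l' (\<tau> a))) /
        (real (card (fiber A l a)) * real (card (fiber B l' (\<tau> a))))))"
  proof (intro sum_list_mono, clarify)
    fix A' B' z assume L: "(A', B', z) \<in> set Ls"
    let ?\<mu> = "real (card A') * real (card B') / (real (card A) * real (card B))"
    let ?r = "\<Sum>(l, l', a)\<in>typical_triples \<epsilon> \<tau> A B.
        (real (card (fiber A' l a)) * real (card (fiber B' l' (\<tau> a)))) /
        (real (card (fiber A l a)) * real (card (fiber B l' (\<tau> a))))"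
    have "\<phi> z * (1 / 2 ^ e) \<le> 1 / 2 ^ e"
      using \<phi> by (intro mult_left_le_one_le) auto
    then have "?N * (?c * (\<phi> z * ?\<mu>) - 1 / 2 ^ e) \<le> ?N * (?c * (\<phi> z * ?\<mu>) - \<phi> z * (1 / 2 ^ e))"
      by (intro mult_left_mono diff_left_mono) auto
    also have "\<dots> = \<phi> z * (?N * (?c * ?\<mu> - 1 / 2 ^ e))"
      by (simp only: right_diff_distrib mult.left_commute)
    also have "\<dots> \<le> \<phi> z * ?r"
      using Ls(2)[OF L] sub \<phi>
      by (intro mult_left_mono plant_rectangle[OF sub _ _ _ _ \<tau> dA dB \<epsilon> \<kappa>]) auto
    finally show "?N * (?c * (\<phi> z * ?\<mu>) - 1 / 2 ^ e) \<le> (\<Sum>(l, l', a)\<in>typical_triples \<epsilon> \<tau> A B.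
      \<phi> z * (real (card (fiber A' l a)) * real (card (fiber B' l' (\<tau> a))) /
        (real (card (fiber A l a)) * real (card (fiber B l' (\<tau> a))))))"
      by (simp only: sum_distrib_left split_def)
  qed
  also have "\<dots> = (\<Sum>(l, l', a)\<in>typical_triples \<epsilon> \<tau> A B. rect_mean (fiber A l a) (fiber B l' (\<tau> a)) ?h)"
    unfolding mean_fiber by (simp only: split_def sum_sum_list_swap)
  finally show ?thesis .
qed

text \<open>
  Only this direction holds in general: atypically large fibers can make the collision far more
  likely than under the uniform distribution. Errors, which must not grow, are therefore fed in
  through their complements.
\<close>

lemma plant:
  fixes p :: "'w \<Rightarrow> real" and \<phi> :: "'w \<Rightarrow> 'o \<Rightarrow> real" and \<epsilon> \<kappa> :: real
  assumes sub: "A \<subseteq> S" "B \<subseteq> S" and ne: "A \<noteq> {}" "B \<noteq> {}"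
    and W: "\<And>w. w \<in> W \<Longrightarrow> 0 \<le> p w"
    and bits: "\<And>w x y. w \<in> W \<Longrightarrow> x \<in> A \<Longrightarrow> y \<in> B \<Longrightarrow> bits_communicated (P w) x y \<le> D"
    and \<phi>: "\<And>w z. w \<in> W \<Longrightarrow> 0 \<le> \<phi> w z \<and> \<phi> w z \<le> 1"
    and h: "\<And>x y. x \<in> A \<Longrightarrow> y \<in> B \<Longrightarrow> h x y = (\<Sum>w\<in>W. p w * \<phi> w (run_protocol (P w) x y))"
    and \<tau>: "bij_betw \<tau> V V"
    and dA: "card S \<le> 2 ^ d * card A" and dB: "card S \<le> 2 ^ d * card B"
    and \<epsilon>: "0 < \<epsilon>" "\<epsilon> \<le> 1" and \<kappa>: "8 * (d + e) / \<epsilon>\<^sup>2 \<le> \<kappa> * m" "4 * \<kappa> + 4 * \<epsilon> < 1"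
    and c: "c = (1 - 4 * \<kappa> - 4 * \<epsilon>) * rect_mean A B h - (\<Sum>w\<in>W. p w) * (2 ^ D / 2 ^ e)" "0 < c"
  obtains l l' a where "l < m" "l' < m" "a \<in> V"
    "(1 - \<epsilon>) * card A \<le> card V * card (fiber A l a)"
    "(1 - \<epsilon>) * card B \<le> card V * card (fiber B l' (\<tau> a))"
    "c \<le> rect_mean (fiber A l a) (fiber B l' (\<tau> a)) h"
proof -
  let ?G = "typical_triples \<epsilon> \<tau> A B" and ?N = "real m ^ 2 * card V" and ?c = "1 - 4 * \<kappa> - 4 * \<epsilon>"
  let ?f = "\<lambda>w x y. \<phi> w (run_protocol (P w) x y)"
  have mean_h: "rect_mean A1 B1 h = (\<Sum>w\<in>W. p w * rect_mean A1 B1 (?f w))"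
    if "A1 \<subseteq> A" "B1 \<subseteq> B" for A1 B1
  proof -
    have "(\<Sum>x\<in>A1. \<Sum>y\<in>B1. h x y) = (\<Sum>x\<in>A1. \<Sum>y\<in>B1. \<Sum>w\<in>W. p w * ?f w x y)"
      using that by (intro sum.cong) (auto simp: h subset_eq)
    also have "\<dots> = (\<Sum>x\<in>A1. \<Sum>w\<in>W. \<Sum>y\<in>B1. p w * ?f w x y)"
      by (intro sum.cong refl sum.swap)
    also have "\<dots> = (\<Sum>w\<in>W. \<Sum>x\<in>A1. \<Sum>y\<in>B1. p w * ?f w x y)"
      by (rule sum.swap)
    finally show ?thesis
      by (simp add: rect_mean_def sum_divide_distrib sum_distrib_left)
  qed
  have "?N * c = (\<Sum>w\<in>W. p w * (?N * (?c * rect_mean A B (?f w) - 2 ^ D / 2 ^ e)))"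
    unfolding c(1) mean_h[OF subset_refl subset_refl]
    by (simp add: sum_distrib_left sum_distrib_right sum_divide_distrib sum_subtractf right_diff_distrib mult_ac)
  also have "\<dots> \<le> (\<Sum>w\<in>W. p w * (\<Sum>(l, l', a)\<in>?G. rect_mean (fiber A l a) (fiber B l' (\<tau> a)) (?f w)))"
    using W bits \<phi> by (intro sum_mono mult_left_mono plant_run[OF sub ne _ _ \<tau> dA dB \<epsilon> \<kappa>]) auto
  also have "\<dots> = (\<Sum>(l, l', a)\<in>?G. \<Sum>w\<in>W. p w * rect_mean (fiber A l a) (fiber B l' (\<tau> a)) (?f w))"
    by (simp add: sum_distrib_left split_def sum.swap[of _ W])
  also have "\<dots> = (\<Sum>(l, l', a)\<in>?G. rect_mean (fiber A l a) (fiber B l' (\<tau> a)) h)"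
  proof (intro sum.cong refl, clarify)
    fix l l' a
    show "(\<Sum>w\<in>W. p w * rect_mean (fiber A l a) (fiber B l' (\<tau> a)) (?f w)) =
        rect_mean (fiber A l a) (fiber B l' (\<tau> a)) h"
      by (rule mean_h[symmetric]) (auto simp: fiber_def)
  qed
  finally have sum_ge: "?N * c \<le> (\<Sum>(l, l', a)\<in>?G. rect_mean (fiber A l a) (fiber B l' (\<tau> a)) h)" .
  have "0 < ?N * c" using m_pos card_V_pos c(2) by simp
  then have "?G \<noteq> {}" using sum_ge by auto
  \<comment> \<open>Some typical triple reaches the average. There may be fewer than
    \<open>?N\<close> of them, which only helps because \<open>c\<close> is positive.\<close>
  have "\<exists>(l, l', a)\<in>?G. c \<le> rect_mean (fiber A l a) (fiber B l' (\<tau> a)) h"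
  proof (rule ccontr)
    assume "\<not> ?thesis"
    then have "(\<Sum>(l, l', a)\<in>?G. rect_mean (fiber A l a) (fiber B l' (\<tau> a)) h) < (\<Sum>g\<in>?G. c)"
      using \<open>?G \<noteq> {}\<close> by (intro sum_strict_mono finite_typical_triples) (auto simp: not_le)
    also have "\<dots> \<le> ?N * c"
      using of_nat_mono[OF card_typical_triples_le, where 'a = real] c(2) by simp
    finally show False using sum_ge by simp
  qed
  then show ?thesis
    using that bij_betwE[OF \<tau>] by (auto simp: typical_triples_def atypical_def)
qed

end

section \<open>Empirical output distributions\<close>

lemma bitstrings_eq: "bitstrings n = lists_of_length UNIV n"
  by (simp add: bitstrings_def lists_of_length_def)

lemma finite_bitstrings [simp]: "finite (bitstrings n)"
  by (simp add: bitstrings_eq)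

lemma card_bitstrings [simp]: "card (bitstrings n) = 2 ^ n"
  by (simp add: bitstrings_eq card_lists_of_length)

lemma bitstrings_nonempty [simp]: "bitstrings n \<noteq> {}"
  by (metis card_bitstrings card.empty power_not_zero zero_neq_numeral)

lemma xor_string_in: "s \<in> bitstrings n \<Longrightarrow> a \<in> bitstrings n \<Longrightarrow> xor_string s a \<in> bitstrings n"
  by (simp add: bitstrings_def xor_string_def)

lemma xor_string_cancel:
  assumes "s \<in> bitstrings n" "a \<in> bitstrings n"
  shows "xor_string s (xor_string s a) = a" "xor_string a (xor_string s a) = s"
  using assms by (auto simp: bitstrings_def xor_string_def intro!: nth_equalityI)

lemma bij_betw_xor_string:
  assumes "s \<in> bitstrings n"
  shows "bij_betw (xor_string s) (bitstrings n) (bitstrings n)"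
  by (rule bij_betwI[where g = "xor_string s"])
    (use assms in \<open>auto simp: xor_string_in xor_string_cancel\<close>)

definition frequency :: "'a list \<Rightarrow> 'a \<Rightarrow> real" where
  "frequency zs s = count_list zs s / length zs"

lemma frequency_nonneg: "0 \<le> frequency zs s"
  by (simp add: frequency_def)

lemma sum_frequency:
  assumes "finite S" "set zs \<subseteq> S" "zs \<noteq> []"
  shows "(\<Sum>s\<in>S. frequency zs s) = 1"
proof -
  have "(\<Sum>s\<in>S. count_list zs s) = length zs"
    using assms(2) by (metis assms(1) sum_count_set)
  then show ?thesis
    using assms(3) by (simp add: frequency_def flip: sum_divide_distrib of_nat_sum)
qed

lemma sum_of_bool_eq:
  fixes g :: "'a \<Rightarrow> real"
  assumes "finite S" "z \<in> S"
  shows "(\<Sum>s\<in>S. g s * of_bool (z = s)) = g z"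
  using assms by (simp add: of_bool_def if_distrib cong: if_cong)

text \<open>Expanding the square, the sum of the squared probabilities is the chance that two
  independent seeds give equal outputs, and the cross term is split evenly between the two seeds. No
  probability is left on the right, only values observable in two runs.\<close>

lemma sq_deviation_eq_mean:
  fixes F :: "'s \<Rightarrow> real"
  assumes "finite S" "finite R" "R \<noteq> {}" and out: "\<And>r. r \<in> R \<Longrightarrow> out r \<in> S"
  shows "(\<Sum>s\<in>S. (F s - mean R (\<lambda>r. of_bool (out r = s)))\<^sup>2) =
    mean R (\<lambda>r. mean R (\<lambda>r'. (\<Sum>s\<in>S. (F s)\<^sup>2) - F (out r) - F (out r') + of_bool (out r = out r')))"
proof -
  define N where "N = real (card R)"
  have N_pos: "0 < N" using assms(2,3) by (simp add: N_def card_gt_0_iff)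
  define p where "p s = mean R (\<lambda>r. of_bool (out r = s))" for s
  have sum_mult_p: "(\<Sum>s\<in>S. g s * p s) = mean R (\<lambda>r. g (out r))" for g
  proof -
    have "(\<Sum>s\<in>S. g s * p s) = (\<Sum>s\<in>S. \<Sum>r\<in>R. g s * of_bool (out r = s)) / N"
      by (simp only: p_def mean_def N_def sum_distrib_left sum_divide_distrib times_divide_eq_right)
    also have "\<dots> = (\<Sum>r\<in>R. \<Sum>s\<in>S. g s * of_bool (out r = s)) / N"
      by (subst sum.swap) (rule refl)
    also have "\<dots> = mean R (\<lambda>r. g (out r))"
      unfolding mean_def N_def using out assms(1)
      by (intro arg_cong2[of _ _ _ _ "(/)"] sum.cong refl sum_of_bool_eq) auto
    finally show ?thesis .
  qed
  have p_out: "p (out r) = mean R (\<lambda>r'. of_bool (out r = out r'))" for r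
    by (simp add: p_def eq_commute)
  have "(\<Sum>s\<in>S. (F s - p s)\<^sup>2) = (\<Sum>s\<in>S. (F s)\<^sup>2) - 2 * (\<Sum>s\<in>S. F s * p s) + (\<Sum>s\<in>S. p s * p s)"
    by (simp add: power2_diff sum.distrib sum_subtractf sum_distrib_left mult.assoc flip: power2_eq_square)
  also have "\<dots> = (\<Sum>s\<in>S. (F s)\<^sup>2) - 2 * mean R (\<lambda>r. F (out r)) + mean R (\<lambda>r. mean R (\<lambda>r'. of_bool (out r = out r')))"
    by (simp add: sum_mult_p p_out)
  also have "\<dots> = mean R (\<lambda>r. mean R (\<lambda>r'. (\<Sum>s\<in>S. (F s)\<^sup>2) - F (out r) - F (out r') + of_bool (out r = out r')))"
    using N_pos unfolding mean_def N_def[symmetric]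
    by (simp add: sum.distrib sum_subtractf add_divide_distrib diff_divide_distrib flip: N_def sum_divide_distrib)
  finally show ?thesis by (simp add: p_def)
qed

text \<open>The count of \<open>s\<close> is a sum of K independent indicators, so its frequency has
  variance at most p s / K. The numbers p s add up to 1, which is why the size of \<open>S\<close>
  does not enter.\<close>

lemma mean_sq_deviation_frequency:
  assumes "finite S" "finite R" "R \<noteq> {}" and out: "\<And>r. r \<in> R \<Longrightarrow> out r \<in> S" and "0 < K"
  shows "mean (lists_of_length R K)
    (\<lambda>rs. \<Sum>s\<in>S. (frequency (map out rs) s - mean R (\<lambda>r. of_bool (out r = s)))\<^sup>2) \<le> 1 / K"
proof -
  define N where "N = real (card R)"
  have N_pos: "0 < N" using assms(2,3) by (simp add: N_def card_gt_0_iff)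
  define p where "p s = mean R (\<lambda>r. of_bool (out r = s))" for s
  define f where "f s r = of_bool (out r = s) - p s" for s r
  have sum_f: "(\<Sum>r\<in>R. f s r) = 0" for s
    using N_pos by (simp add: f_def sum_subtractf p_def mean_def flip: N_def)
  have dev: "frequency (map out rs) s - p s = sum_list (map (f s) rs) / K"
    if "rs \<in> lists_of_length R K" for rs s
  proof -
    have "length rs = K" using that by (simp add: lists_of_length_def)
    have "sum_list (map (f s) rs) = count_list (map out rs) s - length rs * p s"
      by (induction rs) (auto simp: f_def algebra_simps)
    then show ?thesis
      using \<open>0 < K\<close> \<open>length rs = K\<close> by (simp add: frequency_def field_simps)
  qed
  have sum_out: "(\<Sum>r\<in>R. of_bool (out r = s)) = N * p s" for s
    using N_pos by (simp add: p_def mean_def flip: N_def)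
  have sum_sq_f: "(\<Sum>r\<in>R. (f s r)\<^sup>2) \<le> N * p s" for s
  proof -
    have "(\<Sum>r\<in>R. (f s r)\<^sup>2) = (\<Sum>r\<in>R. of_bool (out r = s) - 2 * p s * of_bool (out r = s) + (p s)\<^sup>2)"
      by (intro sum.cong) (auto simp: f_def power2_diff)
    also have "\<dots> = N * p s - 2 * p s * (N * p s) + N * (p s)\<^sup>2"
      by (simp add: sum.distrib sum_subtractf sum_out N_def flip: sum_distrib_left)
    also have "\<dots> \<le> N * p s" using N_pos by (simp add: power2_eq_square)
    finally show ?thesis .
  qed
  have sum_p: "(\<Sum>s\<in>S. p s) = 1"
  proof -
    have "(\<Sum>s\<in>S. p s) = (\<Sum>s\<in>S. \<Sum>r\<in>R. 1 * of_bool (out r = s)) / N"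
      by (simp add: p_def mean_def N_def sum_divide_distrib)
    also have "\<dots> = (\<Sum>r\<in>R. \<Sum>s\<in>S. 1 * of_bool (out r = s)) / N"
      by (subst sum.swap) (rule refl)
    also have "\<dots> = (\<Sum>r\<in>R. 1) / N"
      using out assms(1) by (intro arg_cong2[of _ _ _ _ "(/)"] sum.cong refl sum_of_bool_eq) auto
    finally show ?thesis using N_pos by (simp add: N_def)
  qed
  have "(\<Sum>rs\<in>lists_of_length R K. \<Sum>s\<in>S. (frequency (map out rs) s - p s)\<^sup>2) =
      (\<Sum>rs\<in>lists_of_length R K. \<Sum>s\<in>S. (sum_list (map (f s) rs))\<^sup>2 / K\<^sup>2)"
    by (intro sum.cong) (auto simp: dev power_divide)
  also have "\<dots> = (\<Sum>s\<in>S. \<Sum>rs\<in>lists_of_length R K. (sum_list (map (f s) rs))\<^sup>2 / K\<^sup>2)"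
    by (rule sum.swap)
  also have "\<dots> \<le> (\<Sum>s\<in>S. N ^ K * p s / K)"
  proof (rule sum_mono)
    fix s
    have "N * (\<Sum>rs\<in>lists_of_length R K. (sum_list (map (f s) rs))\<^sup>2) = K * N ^ K * (\<Sum>r\<in>R. (f s r)\<^sup>2)"
      using sum_power2_sum_list[OF assms(2) sum_f] by (simp add: N_def)
    also have "\<dots> \<le> K * N ^ K * (N * p s)"
      using sum_sq_f N_pos by (intro mult_left_mono) auto
    finally have "(\<Sum>rs\<in>lists_of_length R K. (sum_list (map (f s) rs))\<^sup>2) \<le> K * N ^ K * p s"
      using N_pos by simp
    then have "(\<Sum>rs\<in>lists_of_length R K. (sum_list (map (f s) rs))\<^sup>2) / K\<^sup>2 \<le> K * N ^ K * p s / K\<^sup>2"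
      by (rule divide_right_mono) simp
    then show "(\<Sum>rs\<in>lists_of_length R K. (sum_list (map (f s) rs))\<^sup>2 / K\<^sup>2) \<le> N ^ K * p s / K"
      using \<open>0 < K\<close> by (simp add: power2_eq_square flip: sum_divide_distrib)
  qed
  also have "\<dots> = N ^ K / K"
    by (simp add: sum_p flip: sum_divide_distrib sum_distrib_left)
  finally show ?thesis
    using N_pos assms(2) unfolding p_def[symmetric]
    by (simp add: mean_def card_lists_of_length N_def field_simps)
qed

lemma pmf_output_distribution:
  "pmf (output_distribution Q x y) s =
    mean (bitstrings (random_bits Q)) (\<lambda>r. of_bool (run_protocol (tree_of Q r) x y = s))"
  by (simp add: output_distribution_def pmf_map measure_pmf_of_set mean_def of_bool_def sum.If_cases vimage_def)

definition sq_error ::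
    "nat \<Rightarrow> ('a, 'b, bool list) randomized_protocol \<Rightarrow> (bool list \<Rightarrow> real) \<Rightarrow> 'a \<Rightarrow> 'b \<Rightarrow> real" where
  "sq_error n Q F x y = (\<Sum>s\<in>bitstrings n. (F s - pmf (output_distribution Q x y) s)\<^sup>2)"

lemma sq_error_nonneg: "0 \<le> sq_error n Q F x y"
  by (simp add: sq_error_def sum_nonneg)

lemma sq_error_ge:
  "s \<in> bitstrings n \<Longrightarrow> (F s - pmf (output_distribution Q x y) s)\<^sup>2 \<le> sq_error n Q F x y"
  unfolding sq_error_def by (rule member_le_sum) auto

section \<open>Input vectors and errors\<close>

lemma sum_PiE_component:
  fixes \<phi> :: "'b \<Rightarrow> real"
  assumes "finite I" "i \<in> I" "\<And>l. l \<in> I \<Longrightarrow> finite (F l)"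
  shows "(\<Sum>x\<in>PiE I F. \<phi> (x i)) = (\<Prod>l\<in>I - {i}. real (card (F l))) * (\<Sum>z\<in>F i. \<phi> z)"
proof -
  have "(\<Sum>x\<in>PiE I F. \<phi> (x i)) = (\<Sum>x\<in>PiE I F. \<Prod>l\<in>I. if l = i then \<phi> (x l) else 1)"
    using assms(1,2) by (simp add: prod.delta)
  also have "\<dots> = (\<Prod>l\<in>I. \<Sum>z\<in>F l. if l = i then \<phi> z else 1)"
    using assms by (simp add: prod_sum_PiE)
  also have "\<dots> = (\<Sum>z\<in>F i. \<phi> z) * (\<Prod>l\<in>I - {i}. \<Sum>z\<in>F l. if l = i then \<phi> z else 1)"
    using assms by (subst prod.remove[of _ i]) auto
  also have "(\<Prod>l\<in>I - {i}. \<Sum>z\<in>F l. if l = i then \<phi> z else 1) = (\<Prod>l\<in>I - {i}. real (card (F l)))"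
    by (intro prod.cong) auto
  finally show ?thesis by simp
qed

text \<open>The components other than \<open>i\<close> contribute the same factor \<open>c\<close>
  to numerator and denominator and cancel; what remains is independence of the entries of a uniform
  list.\<close>

lemma coordinates_PiE_lists:
  fixes V :: "'v set"
  assumes "finite I" "i \<in> I" "\<And>l. l \<in> I \<Longrightarrow> finite (F l)" "\<And>l. l \<in> I \<Longrightarrow> F l \<noteq> {}"
    and F: "F i = lists_of_length V m" and "finite V" "V \<noteq> {}" "0 < m"
  shows "coordinates (PiE I F) V m (\<lambda>l x. x i ! l)"
proof
  show "finite (PiE I F)" using assms by (intro finite_PiE)
  show "PiE I F \<noteq> {}" using assms by (simp add: PiE_eq_empty_iff)
  show "x i ! l \<in> V" if "l < m" "x \<in> PiE I F" for l x
    using that assms(2) F lists_of_length_nth by (metis PiE_mem)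
  fix \<psi> :: "nat \<Rightarrow> 'v \<Rightarrow> real"
  define c where "c = (\<Prod>l\<in>I - {i}. real (card (F l)))"
  have "c \<noteq> 0"
    using assms by (auto simp: c_def)
  have "real (card (PiE I F)) = (\<Sum>x\<in>PiE I F. (\<lambda>_. 1) (x i))" by simp
  also have "\<dots> = c * (\<Sum>z\<in>F i. (\<lambda>_. 1) z)"
    unfolding c_def using assms(1-3) by (rule sum_PiE_component)
  finally have card: "real (card (PiE I F)) = c * card V ^ m"
    by (simp add: F card_lists_of_length assms)
  have "(\<Sum>x\<in>PiE I F. \<Prod>l<m. \<psi> l (x i ! l)) = c * (\<Sum>z\<in>F i. \<Prod>l<m. \<psi> l (z ! l))"
    unfolding c_def using assms(1-3) by (rule sum_PiE_component)
  also have "\<dots> = c * (\<Prod>l<m. \<Sum>a\<in>V. \<psi> l a)"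
    unfolding F sum_prod_lists_of_length ..
  finally show "(\<Sum>x\<in>PiE I F. \<Prod>l<m. \<psi> l (x i ! l)) / card (PiE I F) = (\<Prod>l<m. (\<Sum>a\<in>V. \<psi> l a) / card V)"
    using \<open>c \<noteq> 0\<close> by (simp add: card prod_dividef)
qed fact+

section \<open>Growth of the parameters\<close>

lemma n_seq_1: "i \<le> 1 \<Longrightarrow> n_seq C i = 2 ^ C"
  by (simp add: n_seq.simps)

lemma n_seq_Suc: "1 \<le> i \<Longrightarrow> n_seq C (Suc i) = n_seq C i ^ 4"
  by (simp add: n_seq.simps[of C "Suc i"])

lemma n_seq_eq_power: "14 \<le> C \<Longrightarrow> \<exists>k\<ge>14. n_seq C i = 2 ^ k"
proof (induction i)
  case 0
  then show ?case by (auto simp: n_seq_1)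
next
  case (Suc i)
  then obtain k where k: "14 \<le> k" "n_seq C i = 2 ^ k" by auto
  show ?case
  proof (cases "i = 0")
    case True
    then show ?thesis using Suc.prems by (auto simp: n_seq_1)
  next
    case False
    then have "n_seq C (Suc i) = 2 ^ (k * 4)" using k by (simp add: n_seq_Suc power_mult)
    then show ?thesis using k(1) by (intro exI[of _ "k * 4"]) auto
  qed
qed

lemma n_seq_ge: "14 \<le> C \<Longrightarrow> 16384 \<le> n_seq C i"
  using n_seq_eq_power[of C i] power_increasing[of 14 _ "2::nat"] by force

text \<open>Makes the error budget summable: level i treats i protocols at error 8 / n_i each, and
  with 6400 = 8 * 800 this amounts to at most 1 / (800 * 2 ^ i). The base case asks for n_1 \<ge>
  12800, which is why the proof takes C \<ge> 14.\<close>

lemma n_seq_large: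
  assumes "14 \<le> C" "1 \<le> i"
  shows "6400 * i * 2 ^ i \<le> n_seq C i"
  using assms(2)
proof (induction i rule: dec_induct)
  case base
  show ?case using n_seq_ge[OF assms(1), of 1] by simp
next
  case (step i)
  have "6400 * Suc i * 2 ^ Suc i \<le> 4 * (6400 * i * 2 ^ i)" using step(1) by simp
  also have "\<dots> \<le> n_seq C i * n_seq C i"
    using step n_seq_ge[OF assms(1), of i] by (intro mult_mono) auto
  also have "\<dots> \<le> n_seq C i ^ 4"
    using n_seq_ge[OF assms(1), of i] power_increasing[of 2 4 "n_seq C i"] by (simp add: power2_eq_square)
  finally show ?case using step(1) by (simp add: n_seq_Suc)
qed

lemma square_le_n_seq:
  assumes "14 \<le> C" "1 \<le> i"
  shows "i * i \<le> n_seq C i"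
proof -
  have "i * i \<le> i * 2 ^ i" by (intro mult_left_mono) (auto simp: less_imp_le)
  also have "\<dots> \<le> n_seq C i" using n_seq_large[OF assms] by simp
  finally show ?thesis .
qed

text \<open>This is the side condition in the definition of the problem, so every pair of lists of
  the right shape is an instance. With n_i = 2 ^ k it reads 100 * k < 2 ^ k / 2.\<close>

lemma m_seq_lt:
  assumes "14 \<le> C"
  shows "real (m_seq C i) < 2 powr (real (n_seq C i) / 2)"
proof -
  obtain k where k: "14 \<le> k" "n_seq C i = 2 ^ k" using n_seq_eq_power[OF assms] by blast
  have "200 * k < 2 ^ k" using k(1)
  proof (induction k rule: dec_induct)
    case (step k)
    then show ?case by simp
  qed simp
  then have "real (200 * k) < 2 ^ k" by (metis of_nat_less_iff of_nat_numeral of_nat_power)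
  then have "real (100 * k) < real (n_seq C i) / 2" by (simp add: k(2))
  then have "2 powr real (100 * k) < 2 powr (real (n_seq C i) / 2)" by simp
  moreover have "real (m_seq C i) = 2 powr real (100 * k)"
    by (simp only: m_seq_def k(2) powr_realpow power_mult[symmetric] mult.commute zero_less_numeral of_nat_power of_nat_numeral)
  ultimately show ?thesis by simp
qed

lemma square_le_two_power_n_seq:
  assumes "14 \<le> C"
  shows "n_seq C i ^ 2 \<le> 2 ^ n_seq C i"
proof -
  obtain k where k: "14 \<le> k" "n_seq C i = 2 ^ k" using n_seq_eq_power[OF assms] by blast
  have "2 * k \<le> 2 ^ k" using k(1)
  proof (induction k rule: dec_induct)
    case (step k)
    then show ?case by simp
  qed simp
  then have "(2::nat) ^ (k * 2) \<le> 2 ^ (2 ^ k)" by (intro power_increasing) auto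
  then show ?thesis by (simp add: k(2) power_mult)
qed

section \<open>The given protocols, their inputs and their errors\<close>

locale protocol_family =
  fixes C t :: nat
    and Q :: "nat \<Rightarrow> nat \<Rightarrow> (nat \<Rightarrow> bool list list, nat \<Rightarrow> bool list list, bool list) randomized_protocol"
  assumes C: "14 \<le> C"
    and cost: "\<And>i j. 1 \<le> j \<Longrightarrow> j \<le> i \<Longrightarrow> i \<le> t \<Longrightarrow> complexity (input_vectors C t) (Q i j) \<le> n_seq C i ^ 4"
    and outputs: "\<And>i j. 1 \<le> j \<Longrightarrow> j \<le> i \<Longrightarrow> i \<le> t \<Longrightarrow>
      outputs_strings_of_length (input_vectors C t) (Q i j) (n_seq C i)"
begin

abbreviation n :: "nat \<Rightarrow> nat" where "n \<equiv> n_seq C"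
abbreviation m :: "nat \<Rightarrow> nat" where "m \<equiv> m_seq C"

definition \<Omega> :: "(nat \<Rightarrow> bool list list) set" where
  "\<Omega> = (\<Pi>\<^sub>E l\<in>{1..t}. lists_of_length (bitstrings (n l)) (m l))"

abbreviation seeds :: "nat \<times> nat \<Rightarrow> bool list set" where
  "seeds k \<equiv> bitstrings (random_bits (Q (fst k) (snd k)))"

abbreviation tree :: "nat \<times> nat \<Rightarrow> bool list \<Rightarrow> (nat \<Rightarrow> bool list list, nat \<Rightarrow> bool list list, bool list) protocol" where
  "tree k \<equiv> tree_of (Q (fst k) (snd k))"

abbreviation strings :: "nat \<times> nat \<Rightarrow> bool list set" where
  "strings k \<equiv> bitstrings (n (fst k))"

definition pairs :: "nat \<Rightarrow> (nat \<times> nat) set" where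
  "pairs i = {(i', j). 1 \<le> j \<and> j \<le> i' \<and> i' \<le> i}"

lemma finite_\<Omega>: "finite \<Omega>"
  unfolding \<Omega>_def by (intro finite_PiE) auto

lemma lists_of_bitstrings_nonempty: "lists_of_length (bitstrings a) b \<noteq> {}"
proof -
  obtain s where "s \<in> bitstrings a" using bitstrings_nonempty by blast
  then have "replicate b s \<in> lists_of_length (bitstrings a) b"
    by (auto simp: lists_of_length_def)
  then show ?thesis by blast
qed

lemma \<Omega>_nonempty: "\<Omega> \<noteq> {}"
  by (simp add: \<Omega>_def PiE_eq_empty_iff lists_of_bitstrings_nonempty)

text \<open>The inputs form a full rectangle with equal sides, so the two players' sides can be
  restricted separately and measured against the same \<open>\<Omega>\<close>.\<close>

lemma input_vectors_eq: "input_vectors C t = \<Omega> \<times> \<Omega>"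
proof -
  have "(X l, Y l) \<in> xor_missing_string_instances (n l) (m l) \<longleftrightarrow>
      X l \<in> lists_of_length (bitstrings (n l)) (m l) \<and> Y l \<in> lists_of_length (bitstrings (n l)) (m l)" for X Y l
    unfolding xor_missing_string_instances_def lists_of_length_def mem_Collect_eq prod.case
    using m_seq_lt[OF C, of l] by blast
  then have "(X, Y) \<in> input_vectors C t \<longleftrightarrow> (X, Y) \<in> \<Omega> \<times> \<Omega>" for X Y
    unfolding input_vectors_def \<Omega>_def PiE_iff mem_Collect_eq prod.case mem_Times_iff fst_conv snd_conv
    by blast
  then show ?thesis
    by (simp add: set_eq_iff split_paired_All)
qed

lemma coordinates_level:
  assumes "1 \<le> i" "i \<le> t"
  shows "coordinates \<Omega> (bitstrings (n i)) (m i) (\<lambda>l x. x i ! l)"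
proof -
  have "0 < m i" using n_seq_ge[OF C, of i] by (simp add: m_seq_def)
  then show ?thesis
    unfolding \<Omega>_def using assms
    by (intro coordinates_PiE_lists lists_of_bitstrings_nonempty) auto
qed

lemma bits_le:
  assumes k: "k \<in> pairs t" and r: "r \<in> seeds k" and "x \<in> \<Omega>" "y \<in> \<Omega>"
  shows "bits_communicated (tree k r) x y \<le> n (fst k) ^ 4"
proof -
  let ?B = "{bits_communicated (tree k r) x y | r x y. r \<in> seeds k \<and> (x, y) \<in> input_vectors C t}"
  have "?B = (\<lambda>(r, x, y). bits_communicated (tree k r) x y) ` (seeds k \<times> input_vectors C t)"
    by force
  then have "finite ?B"
    using finite_\<Omega> by (simp add: input_vectors_eq)
  moreover have "bits_communicated (tree k r) x y \<in> ?B"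
    using assms by (auto simp: input_vectors_eq)
  ultimately have "bits_communicated (tree k r) x y \<le> Max ?B" by (rule Max_ge)
  then show ?thesis
    using cost[of "snd k" "fst k"] k by (auto simp: complexity_def pairs_def)
qed

lemma output_in:
  "k \<in> pairs t \<Longrightarrow> r \<in> seeds k \<Longrightarrow> x \<in> \<Omega> \<Longrightarrow> y \<in> \<Omega> \<Longrightarrow> run_protocol (tree k r) x y \<in> strings k"
  using outputs[of "snd k" "fst k"]
  by (auto simp: outputs_strings_of_length_def input_vectors_eq pairs_def)

text \<open>The bounds are required for every list \<open>s\<close>, also outside
  \<open>strings k\<close>, because planting evaluates \<open>pair_weight\<close> on arbitrary lists
  of outputs.\<close>

definition profile :: "nat \<times> nat \<Rightarrow> (bool list \<Rightarrow> real) \<Rightarrow> bool" where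
  "profile k F \<longleftrightarrow> (\<forall>s. 0 \<le> F s \<and> F s \<le> 1) \<and> (\<Sum>s\<in>strings k. F s) = 1"

definition total_error ::
    "(nat \<times> nat) set \<Rightarrow> (nat \<times> nat \<Rightarrow> bool list \<Rightarrow> real) \<Rightarrow> (nat \<Rightarrow> bool list list) \<Rightarrow> (nat \<Rightarrow> bool list list) \<Rightarrow> real" where
  "total_error P F x y = (\<Sum>k\<in>P. sq_error (n (fst k)) (Q (fst k) (snd k)) (F k) x y)"

lemma total_error_nonneg: "0 \<le> total_error P F x y"
  by (simp add: total_error_def sum_nonneg sq_error_nonneg)

text \<open>
  Two independent seeds give an unbiased estimate of the squared error, with values in \<open>[-2, 2]\<close>.
  This is its complement, rescaled to \<open>[0, 1]\<close>.
\<close>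

definition pair_weight :: "(bool list \<Rightarrow> real) \<Rightarrow> nat \<times> nat \<Rightarrow> bool list list \<Rightarrow> real" where
  "pair_weight F k zs = (2 - (\<Sum>s\<in>strings k. (F s)\<^sup>2) + F (zs ! 0) + F (zs ! 1) - of_bool (zs ! 0 = zs ! 1)) / 4"

lemma pair_weight_bounds:
  assumes "profile k F"
  shows "0 \<le> pair_weight F k zs \<and> pair_weight F k zs \<le> 1"
proof -
  have F: "0 \<le> F s" "F s \<le> 1" for s using assms by (auto simp: profile_def)
  have "(\<Sum>s\<in>strings k. (F s)\<^sup>2) \<le> (\<Sum>s\<in>strings k. F s)"
    using F by (intro sum_mono) (simp add: power2_eq_square mult_left_le)
  then have "(\<Sum>s\<in>strings k. (F s)\<^sup>2) \<le> 1" using assms by (simp add: profile_def)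
  moreover have "0 \<le> (\<Sum>s\<in>strings k. (F s)\<^sup>2)" by (simp add: sum_nonneg)
  ultimately show ?thesis
    using F[of "zs ! 0"] F[of "zs ! 1"] by (simp add: pair_weight_def of_bool_def)
qed

text \<open>The shape is the one that planting expects: nonnegative weights, here of total 4, times
  functions with values in [0, 1] of the output of a deterministic protocol, here the run on two
  seeds.\<close>

lemma sq_error_complement:
  assumes k: "k \<in> pairs t" and "x \<in> \<Omega>" "y \<in> \<Omega>"
  shows "2 - sq_error (n (fst k)) (Q (fst k) (snd k)) F x y =
    (\<Sum>(r, r')\<in>seeds k \<times> seeds k. 4 / (real (card (seeds k)))\<^sup>2 *
      pair_weight F k (run_protocol (run_all [tree k r, tree k r']) x y))"
proof -
  define N where "N = real (card (seeds k))"
  let ?o = "\<lambda>r. run_protocol (tree k r) x y"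
  define G where "G = (\<lambda>r r'. (\<Sum>s\<in>strings k. (F s)\<^sup>2) - F (?o r) - F (?o r') + of_bool (?o r = ?o r'))"
  have G_eq: "2 - G r r' = 4 * pair_weight F k [?o r, ?o r']" for r r'
    by (simp add: G_def pair_weight_def)
  have "sq_error (n (fst k)) (Q (fst k) (snd k)) F x y = mean (seeds k) (\<lambda>r. mean (seeds k) (G r))"
    unfolding sq_error_def pmf_output_distribution G_def
    by (rule sq_deviation_eq_mean) (use assms output_in in auto)
  also have "\<dots> = (\<Sum>r\<in>seeds k. \<Sum>r'\<in>seeds k. G r r') / N\<^sup>2"
    by (simp add: mean_def power2_eq_square N_def flip: sum_divide_distrib)
  finally have "2 - sq_error (n (fst k)) (Q (fst k) (snd k)) F x y =
      (\<Sum>r\<in>seeds k. \<Sum>r'\<in>seeds k. 2 - G r r') / N\<^sup>2"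
    by (simp add: sum_subtractf diff_divide_distrib power2_eq_square N_def)
  also have "\<dots> = (\<Sum>r\<in>seeds k. \<Sum>r'\<in>seeds k. 4 / N\<^sup>2 * pair_weight F k [?o r, ?o r'])"
    by (simp add: G_eq sum_divide_distrib)
  finally show ?thesis
    by (simp only: N_def sum.cartesian_product run_run_all list.map)
qed

end

section \<open>Monotonicity of the sizes and averages over rectangles\<close>

lemma n_seq_mono:
  assumes "14 \<le> C" "i \<le> j"
  shows "n_seq C i \<le> n_seq C j"
proof (rule lift_Suc_mono_le[OF _ assms(2)])
  fix i
  show "n_seq C i \<le> n_seq C (Suc i)"
  proof (cases "i = 0")
    case False
    then show ?thesis
      using n_seq_ge[OF assms(1), of i] by (simp add: n_seq_Suc self_le_power)
  qed (simp add: n_seq_1)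
qed

lemma rect_mean_add:
  "rect_mean A B (\<lambda>x y. f x y + g x y) = rect_mean A B f + rect_mean A B g"
  by (simp add: rect_mean_def sum.distrib add_divide_distrib)

lemma rect_mean_diff_const:
  assumes "finite A" "finite B" "A \<noteq> {}" "B \<noteq> {}"
  shows "rect_mean A B (\<lambda>x y. c - f x y) = c - rect_mean A B f"
  using assms by (simp add: rect_mean_def sum_subtractf diff_divide_distrib)

lemma rect_mean_cong:
  "(\<And>x y. x \<in> A \<Longrightarrow> y \<in> B \<Longrightarrow> f x y = g x y) \<Longrightarrow> rect_mean A B f = rect_mean A B g"
  by (simp add: rect_mean_def)

lemma exists_le_rect_mean:
  assumes "finite A" "finite B" "A \<noteq> {}" "B \<noteq> {}"
  shows "\<exists>x\<in>A. \<exists>y\<in>B. f x y \<le> rect_mean A B f"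
proof -
  have "rect_mean A B f = mean A (\<lambda>x. mean B (f x))"
    by (simp add: rect_mean_def mean_def mult.commute flip: sum_divide_distrib)
  then show ?thesis
    using exists_le_mean[OF assms(1,3), of "\<lambda>x. mean B (f x)"] exists_le_mean[OF assms(2,4)]
    by (metis order_trans)
qed

lemma mean_rect_mean_swap:
  "mean R (\<lambda>r. rect_mean A B (f r)) = rect_mean A B (\<lambda>x y. mean R (\<lambda>r. f r x y))"
proof -
  have "(\<Sum>r\<in>R. \<Sum>x\<in>A. \<Sum>y\<in>B. f r x y) = (\<Sum>x\<in>A. \<Sum>y\<in>B. \<Sum>r\<in>R. f r x y)"
    by (subst sum.swap) (intro sum.cong refl sum.swap)
  then show ?thesis
    by (simp add: mean_def rect_mean_def mult_ac flip: sum_divide_distrib)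
qed

section \<open>The two moves on a rectangle: destroying a string and freezing a profile\<close>

context protocol_family
begin

lemma two_powr_n_bound: "(real (n i))\<^sup>2 \<le> 2 ^ n i"
  using of_nat_mono[OF square_le_two_power_n_seq[OF C, of i], where 'a = real] by simp

lemma card_pairs: "1 \<le> i \<Longrightarrow> card (pairs i) \<le> n i"
proof -
  assume "1 \<le> i"
  have "pairs i \<subseteq> {1..i} \<times> {1..i}" by (auto simp: pairs_def)
  then have "card (pairs i) \<le> card ({1..i} \<times> {1..i})" by (intro card_mono) auto
  then show ?thesis using square_le_n_seq[OF C \<open>1 \<le> i\<close>] by (simp add: card_cartesian_product)
qed

lemma finite_pairs: "finite (pairs i)"
  by (rule finite_subset[of _ "{1..i} \<times> {1..i}"]) (auto simp: pairs_def)

lemma pairs_mono: "i \<le> i' \<Longrightarrow> pairs i \<subseteq> pairs i'"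
  by (auto simp: pairs_def)

text \<open>With c_P protocols in \<open>P\<close>, the mean of 2 * c_P - error after planting is at
  least 1 - 8 * \<epsilon> times its old value, minus 4 * c_P * 2 ^ - n_i. Both losses together are
  at most 5 * c_P / n_i ^ 2, and c_P \<le> n_i turns this into 5 / n_i. The codensity exponent of
  each side grows by n_i for the fixed string and by 1 for the factor 1 - \<epsilon> \<ge> 1 /
  2.\<close>

lemma plant_error:
  assumes i: "1 \<le> i" "i \<le> t" and P: "P \<subseteq> pairs i" "P \<noteq> {}"
    and prof: "\<And>k. k \<in> P \<Longrightarrow> profile k (F k)"
    and sub: "A \<subseteq> \<Omega>" "B \<subseteq> \<Omega>" and ne: "A \<noteq> {}" "B \<noteq> {}"
    and dA: "card \<Omega> \<le> 2 ^ d * card A" and dB: "card \<Omega> \<le> 2 ^ d * card B" and d: "d \<le> n i ^ 20"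
    and \<tau>: "rect_mean A B (total_error P F) \<le> \<tau>" "\<tau> \<le> 1"
    and s: "s \<in> bitstrings (n i)"
  obtains A' B' where "A' \<subseteq> A" "B' \<subseteq> B" "A' \<noteq> {}" "B' \<noteq> {}"
    "card \<Omega> \<le> 2 ^ (d + n i + 1) * card A'" "card \<Omega> \<le> 2 ^ (d + n i + 1) * card B'"
    "rect_mean A' B' (total_error P F) \<le> \<tau> + 5 / n i"
    "\<forall>x\<in>A'. \<forall>y\<in>B'. \<not> xor_missing_string_solution (n i) (m i) (x i) (y i) s"
proof -
  interpret coordinates \<Omega> "bitstrings (n i)" "m i" "\<lambda>l x. x i ! l"
    using i by (rule coordinates_level)
  define N where "N = real (n i)"
  have N: "16384 \<le> N" using n_seq_ge[OF C, of i] by (simp add: N_def)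
  have fin: "finite A" "finite B" using sub finite_\<Omega> finite_subset by blast+
  have fin_P: "finite P" using P(1) finite_pairs finite_subset by blast
  define c\<^sub>P where "c\<^sub>P = real (card P)"
  have c\<^sub>P: "1 \<le> c\<^sub>P" "c\<^sub>P \<le> N"
  proof -
    show "1 \<le> c\<^sub>P" using fin_P P(2) by (simp add: c\<^sub>P_def Suc_le_eq card_gt_0_iff)
    have "card P \<le> n i" using card_mono[OF finite_pairs P(1)] card_pairs[OF i(1)] by simp
    then show "c\<^sub>P \<le> N" by (simp add: c\<^sub>P_def N_def)
  qed
  define h where "h x y = 2 * c\<^sub>P - total_error P F x y" for x y
  define W where "W = (SIGMA k:P. seeds k \<times> seeds k)"
  define p where "p = (\<lambda>(k, r :: bool list, r' :: bool list). 4 / (real (card (seeds k)))\<^sup>2)"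
  define \<phi> where "\<phi> = (\<lambda>(k, r :: bool list, r' :: bool list). pair_weight (F k) k)"
  define R where "R = (\<lambda>(k, r, r'). run_all [tree k r, tree k r'])"
  \<comment> \<open>Two runs of cost at most n_i ^ 4 each. The further n_i bits in \<open>e\<close>
    make \<open>2 ^ D / 2 ^ e\<close> equal to 2 ^ - n_i, hence at most 1 / n_i ^ 2. The number
    \<open>\<epsilon>\<close> below serves as the planting parameter \<kappa> too.\<close>
  define D where "D = 2 * n i ^ 4"
  define e where "e = D + n i"
  define \<epsilon> where "\<epsilon> = 1 / N ^ 4"
  define E where "E = rect_mean A B (total_error P F)"
  define c where "c = (1 - 4 * \<epsilon> - 4 * \<epsilon>) * rect_mean A B h - (\<Sum>w\<in>W. p w) * (2 ^ D / 2 ^ e)"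
  have in_pairs: "k \<in> pairs t" if "k \<in> P" for k
    using that P(1) pairs_mono[OF i(2)] by blast
  have sum_p: "(\<Sum>w\<in>W. p w) = 4 * c\<^sub>P"
    using fin_P by (simp add: W_def p_def c\<^sub>P_def power2_eq_square flip: sum.Sigma)
  have h_eq: "h x y = (\<Sum>w\<in>W. p w * \<phi> w (run_protocol (R w) x y))" if "x \<in> A" "y \<in> B" for x y
  proof -
    have "h x y = (\<Sum>k\<in>P. 2 - sq_error (n (fst k)) (Q (fst k) (snd k)) (F k) x y)"
      by (simp add: h_def total_error_def sum_subtractf c\<^sub>P_def)
    also have "\<dots> = (\<Sum>k\<in>P. \<Sum>(r, r')\<in>seeds k \<times> seeds k. p (k, r, r') * \<phi> (k, r, r') (run_protocol (R (k, r, r')) x y))"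
      unfolding p_def \<phi>_def R_def prod.case
      using that sub by (intro sum.cong refl sq_error_complement in_pairs) auto
    also have "\<dots> = (\<Sum>w\<in>W. p w * \<phi> w (run_protocol (R w) x y))"
      unfolding W_def using fin_P by (subst sum.Sigma) (auto simp: split_def intro: sum.cong)
    finally show ?thesis .
  qed
  have bits: "bits_communicated (R w) x y \<le> D" if "w \<in> W" "x \<in> A" "y \<in> B" for w x y
  proof -
    obtain k r r' where w: "w = (k, r, r')" by (cases w) auto
    then have k: "k \<in> P" "r \<in> seeds k" "r' \<in> seeds k" using that(1) by (auto simp: W_def)
    have "n (fst k) ^ 4 \<le> n i ^ 4"
      using k(1) P(1) n_seq_mono[OF C, of "fst k" i] by (intro power_mono) (auto simp: pairs_def)
    moreover have "bits_communicated (tree k r) x y \<le> n (fst k) ^ 4" "bits_communicated (tree k r') x y \<le> n (fst k) ^ 4"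
      using k that sub by (auto intro!: bits_le in_pairs)
    moreover have "bits_communicated (R w) x y = bits_communicated (tree k r) x y + bits_communicated (tree k r') x y"
      by (simp add: w R_def)
    ultimately show ?thesis unfolding D_def by linarith
  qed
  have \<epsilon>: "0 < \<epsilon>" "\<epsilon> \<le> 1 / N\<^sup>2 / 64"
  proof -
    show "0 < \<epsilon>" using N by (simp add: \<epsilon>_def)
    have "N\<^sup>2 * 64 \<le> N\<^sup>2 * N\<^sup>2"
      using N by (intro mult_left_mono) (auto simp: power2_eq_square intro: order_trans[OF _ mult_mono[of 16384 N 16384 N]])
    then have "1 / (N\<^sup>2 * N\<^sup>2) \<le> 1 / (N\<^sup>2 * 64)"
      using N by (intro divide_left_mono) auto
    then show "\<epsilon> \<le> 1 / N\<^sup>2 / 64" by (simp add: \<epsilon>_def flip: power_add)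
  qed
  have inv_N2: "1 / N\<^sup>2 \<le> 1 / (64 * N)" "1 / N\<^sup>2 \<le> 1 / 64"
  proof -
    have "64 * N \<le> N\<^sup>2" "64 \<le> N\<^sup>2"
      using N mult_mono[of 64 N N N] mult_mono[of 64 N 1 N] by (auto simp: power2_eq_square)
    then show "1 / N\<^sup>2 \<le> 1 / (64 * N)" "1 / N\<^sup>2 \<le> 1 / 64"
      using N by (auto intro!: divide_left_mono)
  qed
  \<comment> \<open>Here m_i = n_i ^ 100 enters: the left side is at most 32 * n_i ^ 28, the right
    side equals n_i ^ 96.\<close>
  have \<kappa>: "8 * (real d + real e) / \<epsilon>\<^sup>2 \<le> \<epsilon> * m i"
  proof -
    have "real d \<le> N ^ 20" using of_nat_mono[OF d, where 'a = real] by (simp add: N_def)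
    moreover have "real e = 2 * N ^ 4 + N ^ 1" by (simp add: e_def D_def N_def)
    moreover have "N ^ 4 \<le> N ^ 20" "N ^ 1 \<le> N ^ 20" using N by (intro power_increasing; simp)+
    ultimately have "real d + real e \<le> 4 * N ^ 20" by simp
    then have "8 * (real d + real e) / \<epsilon>\<^sup>2 \<le> 8 * (4 * N ^ 20) / \<epsilon>\<^sup>2"
      by (intro divide_right_mono mult_left_mono) auto
    also have "\<dots> = 32 * N ^ 28" by (simp add: \<epsilon>_def power_divide flip: power_mult power_add)
    also have "\<dots> \<le> N ^ 1 * N ^ 28" using N by (intro mult_right_mono) auto
    also have "\<dots> = N ^ 29" by (simp flip: power_Suc)
    also have "\<dots> \<le> N ^ 96" using N by (intro power_increasing) auto
    also have "\<dots> = N ^ 100 / N ^ 4" using N by (subst power_diff[symmetric]) auto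
    also have "\<dots> = \<epsilon> * m i" by (simp add: \<epsilon>_def m_seq_def N_def)
    finally show ?thesis .
  qed
  have E: "0 \<le> E" "E \<le> 1"
    using \<tau> by (auto simp: E_def rect_mean_def total_error_nonneg intro!: divide_nonneg_nonneg sum_nonneg)
  have mean_h: "rect_mean A1 B1 h = 2 * c\<^sub>P - rect_mean A1 B1 (total_error P F)"
    if "A1 \<subseteq> A" "B1 \<subseteq> B" "A1 \<noteq> {}" "B1 \<noteq> {}" for A1 B1
    unfolding h_def using that fin by (intro rect_mean_diff_const) (auto intro: finite_subset)
  have small: "4 * c\<^sub>P * (2 ^ D / 2 ^ e) \<le> 4 * c\<^sub>P * (1 / N\<^sup>2)"
  proof (rule mult_left_mono)
    have "2 ^ D / 2 ^ e = 1 / (2::real) ^ n i" by (simp add: e_def power_add)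
    also have "\<dots> \<le> 1 / N\<^sup>2" using two_powr_n_bound[of i] N by (intro divide_left_mono) (auto simp: N_def)
    finally show "2 ^ D / 2 ^ e \<le> 1 / N\<^sup>2" .
  qed (use c\<^sub>P in auto)
  have c_ge: "2 * c\<^sub>P - E - 5 * c\<^sub>P / N\<^sup>2 \<le> c"
  proof -
    have "8 * \<epsilon> * (2 * c\<^sub>P - E) \<le> 8 * (1 / N\<^sup>2 / 64) * (2 * c\<^sub>P)"
      using \<epsilon> E c\<^sub>P by (intro mult_mono) auto
    also have "\<dots> \<le> c\<^sub>P / N\<^sup>2" using c\<^sub>P N by (simp add: field_simps)
    finally have "8 * \<epsilon> * (2 * c\<^sub>P - E) \<le> c\<^sub>P / N\<^sup>2" .
    moreover have "c = (2 * c\<^sub>P - E) - 8 * \<epsilon> * (2 * c\<^sub>P - E) - 4 * c\<^sub>P * (2 ^ D / 2 ^ e)"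
      unfolding c_def sum_p mean_h[OF subset_refl subset_refl ne] E_def by (simp add: algebra_simps)
    ultimately show ?thesis using small by simp
  qed
  have "5 * c\<^sub>P / N\<^sup>2 \<le> c\<^sub>P / 2"
    using mult_left_mono[OF inv_N2(2), of "5 * c\<^sub>P"] c\<^sub>P by simp
  then have "0 < c" using c_ge E c\<^sub>P by linarith
  have loss: "5 * c\<^sub>P / N\<^sup>2 \<le> 5 / N"
    using c\<^sub>P N by (simp add: field_simps power2_eq_square)
  have bij: "bij_betw (xor_string s) (bitstrings (n i)) (bitstrings (n i))"
    using s by (rule bij_betw_xor_string)
  have p_nonneg: "0 \<le> p w" for w by (simp add: p_def split_def)
  have \<phi>: "0 \<le> \<phi> w z \<and> \<phi> w z \<le> 1" if "w \<in> W" for w z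
    using that prof pair_weight_bounds by (auto simp: \<phi>_def W_def)
  have \<epsilon>_le: "\<epsilon> \<le> 1" "4 * \<epsilon> + 4 * \<epsilon> < 1" using \<epsilon>(2) inv_N2(2) by simp_all
  obtain l l' a where la: "l < m i" "l' < m i" "a \<in> bitstrings (n i)"
    and typA: "(1 - \<epsilon>) * card A \<le> card (bitstrings (n i)) * card (fiber A l a)"
    and typB: "(1 - \<epsilon>) * card B \<le> card (bitstrings (n i)) * card (fiber B l' (xor_string s a))"
    and c_le: "c \<le> rect_mean (fiber A l a) (fiber B l' (xor_string s a)) h"
    by (rule plant[OF sub ne p_nonneg bits \<phi> h_eq bij dA dB \<epsilon>(1) \<epsilon>_le(1) \<kappa> \<epsilon>_le(2) c_def \<open>0 < c\<close>])
  let ?A = "fiber A l a" and ?B = "fiber B l' (xor_string s a)"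
  have fiber_sub: "fiber M l a \<subseteq> M" for M l a by (auto simp: fiber_def)
  have density: "card \<Omega> \<le> 2 ^ (d + n i + 1) * card (fiber M l a)"
    if M: "card \<Omega> \<le> 2 ^ d * card M" and "(1 - \<epsilon>) * card M \<le> card (bitstrings (n i)) * card (fiber M l a)" for M l a
  proof -
    have "card M / 2 \<le> (1 - \<epsilon>) * card M"
      using \<epsilon>(2) inv_N2(2) mult_right_mono[of "1 / 2" "1 - \<epsilon>" "card M"] by simp
    also note that(2)
    finally have "real (card M) \<le> real (2 * 2 ^ n i * card (fiber M l a))" by simp
    then have "card M \<le> 2 * 2 ^ n i * card (fiber M l a)" by (simp only: of_nat_le_iff)
    then have "2 ^ d * card M \<le> 2 ^ d * (2 * 2 ^ n i * card (fiber M l a))" by (intro mult_left_mono) auto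
    also have "\<dots> = 2 ^ (d + n i + 1) * card (fiber M l a)" by (simp add: power_add)
    finally show ?thesis using M by linarith
  qed
  have \<Omega>_pos: "0 < card \<Omega>" using finite_\<Omega> \<Omega>_nonempty by (simp add: card_gt_0_iff)
  have dens: "card \<Omega> \<le> 2 ^ (d + n i + 1) * card ?A" "card \<Omega> \<le> 2 ^ (d + n i + 1) * card ?B"
    using density dA dB typA typB by blast+
  then have ne': "?A \<noteq> {}" "?B \<noteq> {}" using \<Omega>_pos by auto
  have "2 * c\<^sub>P - rect_mean ?A ?B (total_error P F) \<ge> c"
    using c_le mean_h[OF fiber_sub fiber_sub ne'] by simp
  then have err: "rect_mean ?A ?B (total_error P F) \<le> \<tau> + 5 / n i"
    using c_ge loss \<tau>(1) by (simp add: N_def E_def)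
  have "\<forall>x\<in>?A. \<forall>y\<in>?B. \<not> xor_missing_string_solution (n i) (m i) (x i) (y i) s"
  proof (intro ballI)
    fix x y assume "x \<in> ?A" "y \<in> ?B"
    then have "xor_string (x i ! l) (y i ! l') = s"
      using xor_string_cancel(2)[OF s la(3)] by (simp add: fiber_def)
    then show "\<not> xor_missing_string_solution (n i) (m i) (x i) (y i) s"
      using la(1,2) unfolding xor_missing_string_solution_def by blast
  qed
  then show ?thesis
    by (rule that[OF fiber_sub fiber_sub ne' dens err])
qed

text \<open>\<open>T\<close> stands for the error accumulated earlier; adding the new error to it
  lets one good leaf control both. Write K for \<open>n (fst k)\<close>. Averaging fixes K seeds of
  mean error at most 1 / K, and the joint run on them is deterministic of cost K ^ 5, so that each
  leaf freezes the observed outputs. Choosing a leaf with \<eta> = 2 ^ - K adds at most 2 / K to the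
  error and K to the exponent.\<close>

lemma sample_error:
  assumes k: "k \<in> pairs t"
    and sub: "A \<subseteq> \<Omega>" "B \<subseteq> \<Omega>" and ne: "A \<noteq> {}" "B \<noteq> {}"
    and T: "\<And>x y. 0 \<le> T x y" and \<tau>: "rect_mean A B T \<le> \<tau>" "0 \<le> \<tau>" "\<tau> + 1 / n (fst k) \<le> 1"
  obtains zs A' B' where "A' \<subseteq> A" "B' \<subseteq> B" "A' \<noteq> {}" "B' \<noteq> {}"
    "card A \<le> 2 ^ (n (fst k) ^ 5 + n (fst k)) * card A'" "card B \<le> 2 ^ (n (fst k) ^ 5 + n (fst k)) * card B'"
    "profile k (frequency zs)"
    "rect_mean A' B' (\<lambda>x y. T x y + sq_error (n (fst k)) (Q (fst k) (snd k)) (frequency zs) x y) \<le> \<tau> + 3 / n (fst k)"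
proof -
  define K where "K = n (fst k)"
  define err where "err = sq_error K (Q (fst k) (snd k))"
  define outs where "outs rs x y = map (\<lambda>r. run_protocol (tree k r) x y) rs" for rs x y
  define N where "N = real K"
  have N: "16384 \<le> N" and "0 < K" using n_seq_ge[OF C, of "fst k"] by (simp_all add: N_def K_def)
  have fin: "finite A" "finite B" using sub finite_\<Omega> finite_subset by blast+
  let ?L = "lists_of_length (seeds k) K"
  have mean_err: "mean ?L (\<lambda>rs. err (frequency (outs rs x y)) x y) \<le> 1 / K" if "x \<in> A" "y \<in> B" for x y
    unfolding err_def sq_error_def pmf_output_distribution outs_def
    using that \<open>0 < K\<close> output_in[OF k _ subsetD[OF sub(1)] subsetD[OF sub(2)]]
    by (intro mean_sq_deviation_frequency) (auto simp: K_def)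
  have "mean ?L (\<lambda>rs. rect_mean A B (\<lambda>x y. err (frequency (outs rs x y)) x y)) \<le> 1 / K"
  proof -
    have "(\<Sum>x\<in>A. \<Sum>y\<in>B. mean ?L (\<lambda>rs. err (frequency (outs rs x y)) x y)) \<le> (\<Sum>x\<in>A. \<Sum>y\<in>B. 1 / K)"
      using mean_err by (intro sum_mono) auto
    then show ?thesis
      unfolding mean_rect_mean_swap using fin ne
      by (simp add: rect_mean_def card_gt_0_iff pos_divide_le_eq)
  qed
  moreover obtain rs where "rs \<in> ?L" and
    "rect_mean A B (\<lambda>x y. err (frequency (outs rs x y)) x y) \<le>
      mean ?L (\<lambda>rs. rect_mean A B (\<lambda>x y. err (frequency (outs rs x y)) x y))"
    using exists_le_mean[of ?L "\<lambda>rs. rect_mean A B (\<lambda>x y. err (frequency (outs rs x y)) x y)"]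
      lists_of_bitstrings_nonempty by auto
  ultimately have rs: "set rs \<subseteq> seeds k" "length rs = K"
    and err_rs: "rect_mean A B (\<lambda>x y. err (frequency (outs rs x y)) x y) \<le> 1 / K"
    by (auto simp: lists_of_length_def)
  define h where "h x y = T x y + err (frequency (outs rs x y)) x y" for x y
  define \<eta> where "\<eta> = (1 / 2 ^ K :: real)"
  have \<eta>: "0 < \<eta>" "\<eta> \<le> 1 / N" "\<eta> \<le> 1 / 2"
  proof -
    have "\<eta> \<le> 1 / N\<^sup>2"
      unfolding \<eta>_def using two_powr_n_bound[of "fst k"] N by (intro divide_left_mono) (auto simp: N_def K_def)
    also have "\<dots> \<le> 1 / N" using N by (intro divide_left_mono) (auto simp: power2_eq_square)
    finally show "\<eta> \<le> 1 / N" .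
    moreover have "1 / N \<le> 1 / 2" using N by (intro divide_left_mono) auto
    ultimately show "\<eta> \<le> 1 / 2" by simp
  qed (simp add: \<eta>_def)
  define P where "P = run_all (map (tree k) rs)"
  have run_P: "run_protocol P x y = outs rs x y" for x y
    by (simp add: P_def outs_def)
  obtain A' B' zs where sub': "A' \<subseteq> A" "B' \<subseteq> B" and ne': "A' \<noteq> {}" "B' \<noteq> {}"
    and run: "\<And>x y. x \<in> A' \<Longrightarrow> y \<in> B' \<Longrightarrow> run_protocol P x y = zs"
    and big: "real (card A') * real (card B') \<ge> \<eta> / 2 ^ (K ^ 5) * (real (card A) * real (card B))"
    and mean_h: "rect_mean A' B' h \<le> (\<tau> + 1 / N) / (1 - \<eta>)"
  proof (rule good_leaf[OF fin ne])
    show "bits_communicated P x y \<le> K ^ 5" if "x \<in> A" "y \<in> B" for x y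
    proof -
      have "(\<Sum>r\<leftarrow>rs. bits_communicated (tree k r) x y) \<le> (\<Sum>r\<leftarrow>rs. K ^ 4)"
        using rs(1) that sub unfolding K_def by (intro sum_list_mono bits_le[OF k]) auto
      then show ?thesis
        using rs(2) by (simp add: P_def comp_def sum_list_triv power_numeral_reduce)
    qed
    show "0 \<le> h x y" for x y by (simp add: h_def err_def T sq_error_nonneg)
    show "rect_mean A B h \<le> \<tau> + 1 / N"
      using \<tau>(1) err_rs unfolding h_def by (simp add: rect_mean_add N_def)
    show "0 < \<tau> + 1 / N" using \<tau>(2) N by (intro add_nonneg_pos) auto
    show "0 < \<eta>" "\<eta> < 1" using \<eta> by simp_all
  qed (use that in blast)
  have fin': "finite A'" "finite B'" using sub' fin finite_subset by blast+
  have prof: "profile k (frequency zs)"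
  proof -
    obtain x y where xy: "x \<in> A'" "y \<in> B'" using ne' by blast
    have zs: "zs = outs rs x y" using run[OF xy] run_P by simp
    have "set zs \<subseteq> strings k"
      using rs(1) output_in[OF k, of _ x y] xy sub sub' by (auto simp: zs outs_def subset_eq)
    moreover have "zs \<noteq> []" using rs(2) \<open>0 < K\<close> by (auto simp: zs outs_def)
    moreover have "frequency zs s \<le> 1" for s
      using count_le_length[of zs s] by (simp add: frequency_def divide_le_eq_1)
    ultimately show ?thesis
      by (simp add: profile_def frequency_nonneg sum_frequency)
  qed
  have "rect_mean A' B' (\<lambda>x y. T x y + err (frequency zs) x y) = rect_mean A' B' h"
    using run by (intro rect_mean_cong) (simp add: h_def flip: run_P)
  \<comment> \<open>As \<eta> \<le> 1 / 2, the factor 1 / (1 - \<eta>) is at most 1 + 2 * \<eta>. It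
    multiplies a quantity of at most 1, so it adds at most 2 * \<eta> \<le> 2 / N.\<close>
  moreover have "(\<tau> + 1 / N) / (1 - \<eta>) \<le> \<tau> + 3 / N"
  proof -
    have "1 \<le> (1 + 2 * \<eta>) * (1 - \<eta>)"
      using \<eta> mult_left_mono[OF \<eta>(3), of "2 * \<eta>"] by (simp add: algebra_simps)
    then have "1 / (1 - \<eta>) \<le> 1 + 2 * \<eta>" using \<eta> by (simp add: pos_divide_le_eq)
    then have "(\<tau> + 1 / N) * (1 / (1 - \<eta>)) \<le> (\<tau> + 1 / N) * (1 + 2 * \<eta>)"
      using \<tau>(2) N by (intro mult_left_mono) auto
    also have "\<dots> = (\<tau> + 1 / N) + (\<tau> + 1 / N) * (2 * \<eta>)" by (simp add: algebra_simps)
    also have "(\<tau> + 1 / N) * (2 * \<eta>) \<le> 1 * (2 * \<eta>)"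
      using \<tau>(3) \<eta> by (intro mult_right_mono) (auto simp: N_def K_def)
    finally show ?thesis using \<eta> by simp
  qed
  ultimately have err_zs: "rect_mean A' B' (\<lambda>x y. T x y + err (frequency zs) x y) \<le> \<tau> + 3 / N"
    using mean_h by simp
  have dense: "card M \<le> 2 ^ (K ^ 5 + K) * card M'"
    if "0 < card M1" "real (card M') * real (card M1) \<ge> \<eta> / 2 ^ (K ^ 5) * (real (card M) * real (card M1))"
    for M M' M1 :: "(nat \<Rightarrow> bool list list) set"
  proof -
    have "real (card M) \<le> real (2 ^ (K ^ 5 + K) * card M')"
      using that by (simp add: \<eta>_def power_add field_simps)
    then show ?thesis by (simp only: of_nat_le_iff)
  qed
  \<comment> \<open>A bound on the relative size of the product passes to each side, because the
    other side has relative size at most 1.\<close>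
  have "real (card A') * real (card B) \<ge> \<eta> / 2 ^ (K ^ 5) * (real (card A) * real (card B))"
    using sub' fin by (intro order_trans[OF big] mult_left_mono) (auto intro: card_mono)
  then have dense_A: "card A \<le> 2 ^ (K ^ 5 + K) * card A'"
    using fin ne by (intro dense[of B]) (auto simp: card_gt_0_iff)
  have "real (card B') * real (card A) \<ge> \<eta> / 2 ^ (K ^ 5) * (real (card B) * real (card A))"
    unfolding mult.commute[of "real (card B')"] mult.commute[of "real (card B)"]
    using sub' fin by (intro order_trans[OF big] mult_right_mono) (auto intro: card_mono)
  then have dense_B: "card B \<le> 2 ^ (K ^ 5 + K) * card B'"
    using fin ne by (intro dense[of A]) (auto simp: card_gt_0_iff)
  show ?thesis
    by (rule that[OF sub' ne' dense_A[unfolded K_def] dense_B[unfolded K_def] prof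
        err_zs[unfolded err_def N_def K_def]])
qed

end

section \<open>The invariant\<close>

context protocol_family
begin

text \<open>
  Here \<open>d\<close> is the codensity exponent of each side, and \<open>F k\<close> is the profile frozen when the
  protocol with index pair \<open>k\<close> was treated.
\<close>

definition stage ::
    "(nat \<times> nat) set \<Rightarrow> nat \<Rightarrow> real \<Rightarrow> (nat \<Rightarrow> bool list list) set \<Rightarrow> (nat \<Rightarrow> bool list list) set \<Rightarrow>
     (nat \<times> nat \<Rightarrow> bool list \<Rightarrow> real) \<Rightarrow> bool" where
  "stage P d \<tau> A B F \<longleftrightarrow>
     A \<subseteq> \<Omega> \<and> B \<subseteq> \<Omega> \<and> A \<noteq> {} \<and> B \<noteq> {} \<and> card \<Omega> \<le> 2 ^ d * card A \<and> card \<Omega> \<le> 2 ^ d * card B \<and>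
     rect_mean A B (total_error P F) \<le> \<tau> \<and>
     (\<forall>k\<in>P. profile k (F k) \<and> (\<forall>s x y. F k s > 0.55 \<longrightarrow> x \<in> A \<longrightarrow> y \<in> B \<longrightarrow>
       \<not> xor_missing_string_solution (n (fst k)) (m (fst k)) (x (fst k)) (y (fst k)) s))"

lemma stage_mono: "stage P d \<tau> A B F \<Longrightarrow> \<tau> \<le> \<tau>' \<Longrightarrow> stage P d \<tau>' A B F"
  unfolding stage_def by (meson order_trans)

text \<open>Two values above 0.55 would exceed the total mass 1. If no string is heavy, an arbitrary
  one is returned; destroying it does no harm and spares a case distinction.\<close>

lemma profile_majority:
  assumes "profile k F"
  obtains s where "s \<in> strings k" "\<And>s'. s' \<in> strings k \<Longrightarrow> F s' > 0.55 \<Longrightarrow> s' = s"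
proof (cases "\<exists>s\<in>strings k. F s > 0.55")
  case True
  then obtain s where s: "s \<in> strings k" "F s > 0.55" by blast
  have "s' = s" if "s' \<in> strings k" "F s' > 0.55" for s'
  proof (rule ccontr)
    assume "s' \<noteq> s"
    then have "F s + F s' = (\<Sum>u\<in>{s, s'}. F u)" by simp
    also have "\<dots> \<le> (\<Sum>u\<in>strings k. F u)"
      using assms s that by (intro sum_mono2) (auto simp: profile_def)
    finally show False using assms s that by (simp add: profile_def)
  qed
  then show ?thesis using that s by blast
next
  case False
  obtain s where "s \<in> strings k" using bitstrings_nonempty by blast
  then show ?thesis using that False by blast
qed

text \<open>Freezing the profile costs n_i ^ 5 + n_i in the exponent and 3 / n_i in error,
  destroying its heavy string n_i + 1 and 5 / n_i; the sums are covered by n_i ^ 6 and 8 / n_i. The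
  new error joins the total before planting, so planting preserves it as well. Strings destroyed
  earlier remain destroyed because the rectangle only shrinks.\<close>

lemma stage_step:
  assumes st: "stage P d \<tau> A B F" and P: "P \<subseteq> pairs i" and i: "i \<le> t"
    and k: "(i, j) \<in> pairs i" "(i, j) \<notin> P"
    and d: "d + n i ^ 6 \<le> n i ^ 20" and \<tau>: "0 \<le> \<tau>" "\<tau> + 8 / n i \<le> 1"
  shows "\<exists>A' B' F'. stage (insert (i, j) P) (d + n i ^ 6) (\<tau> + 8 / n i) A' B' F'"
proof -
  define k where "k = (i, j)"
  have k_pairs: "k \<in> pairs i" "k \<notin> P" and fst_k: "fst k = i" and i1: "1 \<le> i"
    using k by (auto simp: k_def pairs_def)
  have fin_P: "finite P" using P finite_pairs finite_subset by blast
  have sub: "A \<subseteq> \<Omega>" "B \<subseteq> \<Omega>" and ne: "A \<noteq> {}" "B \<noteq> {}"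
    and dens: "card \<Omega> \<le> 2 ^ d * card A" "card \<Omega> \<le> 2 ^ d * card B"
    and err: "rect_mean A B (total_error P F) \<le> \<tau>"
    and F: "\<And>k. k \<in> P \<Longrightarrow> profile k (F k)"
    and solved: "\<And>k s x y. k \<in> P \<Longrightarrow> F k s > 0.55 \<Longrightarrow> x \<in> A \<Longrightarrow> y \<in> B \<Longrightarrow>
      \<not> xor_missing_string_solution (n (fst k)) (m (fst k)) (x (fst k)) (y (fst k)) s"
    using st unfolding stage_def by blast+
  have n_pos: "16384 \<le> n i" using n_seq_ge[OF C] .
  have "\<tau> + 1 / n (fst k) \<le> \<tau> + 8 / n i"
    unfolding fst_k by (intro add_left_mono divide_right_mono) auto
  then have "\<tau> + 1 / n (fst k) \<le> 1" using \<tau>(2) by linarith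
  note sample = sample_error[OF _ sub ne total_error_nonneg err \<tau>(1) this]
  have "k \<in> pairs t" using k_pairs(1) pairs_mono[OF i] by blast
  then obtain zs A1 B1 where sub1: "A1 \<subseteq> A" "B1 \<subseteq> B" and ne1: "A1 \<noteq> {}" "B1 \<noteq> {}"
    and dens1: "card A \<le> 2 ^ (n (fst k) ^ 5 + n (fst k)) * card A1"
      "card B \<le> 2 ^ (n (fst k) ^ 5 + n (fst k)) * card B1"
    and prof: "profile k (frequency zs)"
    and err1: "rect_mean A1 B1 (\<lambda>x y. total_error P F x y +
      sq_error (n (fst k)) (Q (fst k) (snd k)) (frequency zs) x y) \<le> \<tau> + 3 / n (fst k)"
    by (rule sample)
  note dens1 = dens1[unfolded fst_k] and err1 = err1[unfolded fst_k]
  define F' where "F' = F(k := frequency zs)"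
  have "total_error (insert k P) F' x y =
      total_error P F x y + sq_error (n i) (Q i (snd k)) (frequency zs) x y" for x y
  proof -
    have "total_error P F' x y = total_error P F x y"
      unfolding total_error_def F'_def using k_pairs(2) by (intro sum.cong) auto
    then show ?thesis
      using fin_P k_pairs(2) by (simp add: total_error_def F'_def fst_k)
  qed
  then have err1': "rect_mean A1 B1 (total_error (insert k P) F') \<le> \<tau> + 3 / n i"
    using err1 by (simp cong: rect_mean_cong)
  have F': "profile k' (F' k')" if "k' \<in> insert k P" for k'
    using that F[of k'] prof by (auto simp: F'_def)
  obtain s where s: "s \<in> strings k" "\<And>s'. s' \<in> strings k \<Longrightarrow> F' k s' > 0.55 \<Longrightarrow> s' = s"
    using profile_majority[OF F'[of k]] by blast
  define d1 where "d1 = d + (n i ^ 5 + n i)"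
  have "n i ^ 5 + n i + n i + 1 \<le> n i ^ 6"
  proof -
    have "n i \<le> n i ^ 5" "1 \<le> n i ^ 5" using n_pos by (auto simp: self_le_power)
    then have "n i ^ 5 + n i + n i + 1 \<le> 4 * n i ^ 5" by linarith
    also have "\<dots> \<le> n i * n i ^ 5" using n_pos by (intro mult_right_mono) auto
    finally show ?thesis by (simp flip: power_Suc)
  qed
  then have d1: "d1 + n i + 1 \<le> d + n i ^ 6" by (simp add: d1_def)
  have trans: "card \<Omega> \<le> 2 ^ d1 * card M1"
    if "card \<Omega> \<le> 2 ^ d * card M" "card M \<le> 2 ^ (n i ^ 5 + n i) * card M1"
    for M M1 :: "(nat \<Rightarrow> bool list list) set"
    using order_trans[OF that(1) mult_left_mono[OF that(2), of "2 ^ d"]]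
    by (simp add: d1_def power_add mult.assoc)
  have \<tau>3: "\<tau> + 3 / n i \<le> 1"
    using \<tau>(2) divide_right_mono[of 3 8 "real (n i)"] by simp
  have d1_le: "d1 \<le> n i ^ 20" using d d1 by linarith
  have s_in: "s \<in> bitstrings (n i)" using s(1) by (simp add: fst_k)
  have P': "insert k P \<subseteq> pairs i" "insert k P \<noteq> {}" using P k_pairs(1) by auto
  have sub\<Omega>: "A1 \<subseteq> \<Omega>" "B1 \<subseteq> \<Omega>" using sub sub1 by blast+
  obtain A' B' where sub': "A' \<subseteq> A1" "B' \<subseteq> B1" and ne': "A' \<noteq> {}" "B' \<noteq> {}"
    and dens': "card \<Omega> \<le> 2 ^ (d1 + n i + 1) * card A'" "card \<Omega> \<le> 2 ^ (d1 + n i + 1) * card B'"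
    and err': "rect_mean A' B' (total_error (insert k P) F') \<le> (\<tau> + 3 / n i) + 5 / n i"
    and planted: "\<forall>x\<in>A'. \<forall>y\<in>B'. \<not> xor_missing_string_solution (n i) (m i) (x i) (y i) s"
    by (rule plant_error[OF i1 i P' F' sub\<Omega> ne1 trans[OF dens(1) dens1(1)] trans[OF dens(2) dens1(2)]
        d1_le err1' \<tau>3 s_in])
  have le: "2 ^ (d1 + n i + 1) * c \<le> 2 ^ (d + n i ^ 6) * c" for c :: nat
    using d1 by (intro mult_right_mono power_increasing) auto
  have "stage (insert k P) (d + n i ^ 6) (\<tau> + 8 / n i) A' B' F'"
    unfolding stage_def
  proof (intro conjI ballI allI impI)
    show "A' \<subseteq> \<Omega>" "B' \<subseteq> \<Omega>" using sub sub1 sub' by blast+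
    show "card \<Omega> \<le> 2 ^ (d + n i ^ 6) * card A'" "card \<Omega> \<le> 2 ^ (d + n i ^ 6) * card B'"
      using dens' le order_trans by blast+
    show "rect_mean A' B' (total_error (insert k P) F') \<le> \<tau> + 8 / n i"
      using err' by (simp flip: add_divide_distrib)
    fix k' assume k': "k' \<in> insert k P"
    then show "profile k' (F' k')" by (rule F')
    fix u x y assume u: "F' k' u > 0.55" and xy: "x \<in> A'" "y \<in> B'"
    show "\<not> xor_missing_string_solution (n (fst k')) (m (fst k')) (x (fst k')) (y (fst k')) u"
    proof (cases "k' = k")
      case True
      show ?thesis
      proof
        assume sol: "xor_missing_string_solution (n (fst k')) (m (fst k')) (x (fst k')) (y (fst k')) u"
        \<comment> \<open>A solution has the right length, so heavy values of the profile outside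
          \<open>strings k\<close> need no attention.\<close>
        then have "u \<in> strings k" by (simp add: True xor_missing_string_solution_def)
        then have "u = s" using s(2) u True by blast
        then show False using planted xy sol by (simp add: True fst_k)
      qed
    next
      case False
      then show ?thesis
        using k' u xy sub1 sub' solved[of k' u x y] by (auto simp: F'_def)
    qed
  qed (fact ne')+
  then show ?thesis unfolding k_def by blast
qed

text \<open>The exponent 3 closes the induction: with l = i + 1, the l protocols of level l raise
  the codensity exponent to at most n_l ^ 3 + l * n_l ^ 6 \<le> n_l ^ 12 = n_(l+1) ^ 3, well below
  the n_l ^ 20 that planting allows. The error bound is a partial sum of the geometric series of the
  terms 1 / (800 * 2 ^ l).\<close>

lemma stage_levels:
  assumes "i \<le> t"
  shows "\<exists>d A B F. d \<le> n (Suc i) ^ 3 \<and> stage (pairs i) d ((1 - 1 / 2 ^ i) / 800) A B F"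
  using assms
proof (induction i)
  case 0
  have "pairs 0 = {}" by (auto simp: pairs_def)
  then have "stage (pairs 0) 0 ((1 - 1 / 2 ^ 0) / 800) \<Omega> \<Omega> F" for F
    using \<Omega>_nonempty by (simp add: stage_def total_error_def rect_mean_def)
  then show ?case by blast
next
  case (Suc i)
  let ?l = "Suc i" and ?\<tau> = "(1 - 1 / 2 ^ i) / 800 :: real"
  let ?n = "n (Suc i)"
  obtain d A B F where d: "d \<le> ?n ^ 3" and st: "stage (pairs i) d ?\<tau> A B F"
    using Suc by auto
  have n: "16384 \<le> ?n" using n_seq_ge[OF C] .
  have level: "?l \<le> ?n"
  proof -
    have "?l \<le> ?l * ?l" by simp
    then show ?thesis using square_le_n_seq[OF C, of ?l] by linarith
  qed
  have d_le: "d + j * ?n ^ 6 \<le> ?n ^ 12" if "j \<le> ?l" for j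
  proof -
    have "j * ?n ^ 6 \<le> ?n * ?n ^ 6" using that level by (intro mult_right_mono) auto
    moreover have "?n * ?n ^ 6 = ?n ^ 7" by (simp flip: power_Suc)
    moreover have "?n ^ 3 \<le> ?n ^ 11" "?n ^ 7 \<le> ?n ^ 11" using n by (intro power_increasing; simp)+
    moreover have "2 * ?n ^ 11 \<le> ?n * ?n ^ 11" using n by (intro mult_right_mono) auto
    moreover have "?n * ?n ^ 11 = ?n ^ 12" by (simp flip: power_Suc)
    ultimately show ?thesis using d by linarith
  qed
  have loss: "?l * (8 / ?n) \<le> 1 / (800 * 2 ^ ?l)"
  proof -
    have "real (6400 * ?l * 2 ^ ?l) \<le> real ?n"
      using n_seq_large[OF C, of ?l] by (simp only: of_nat_le_iff)
    then show ?thesis using n by (simp add: field_simps)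
  qed
  have "1 / 2 ^ i = 2 * (1 / (2::real) ^ ?l)" by simp
  then have \<tau>_Suc: "?\<tau> + 1 / (800 * 2 ^ ?l) = (1 - 1 / 2 ^ ?l) / 800" by (simp add: field_simps)
  have \<tau>_nonneg: "0 \<le> ?\<tau>" by (simp add: divide_le_eq_1)
  have "\<exists>A B F. stage (pairs i \<union> {?l} \<times> {1..j}) (d + j * ?n ^ 6) (?\<tau> + j * (8 / ?n)) A B F"
    if "j \<le> ?l" for j
    using that
  proof (induction j)
    case 0
    then show ?case using st by auto
  next
    case (Suc j)
    then obtain A B F where st: "stage (pairs i \<union> {?l} \<times> {1..j}) (d + j * ?n ^ 6) (?\<tau> + j * (8 / ?n)) A B F"
      by auto
    have Suc_mult: "Suc j * (8 / real ?n) = j * (8 / ?n) + 8 / ?n"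
      by (simp add: add_divide_distrib)
    have "\<exists>A' B' F'. stage (insert (?l, Suc j) (pairs i \<union> {?l} \<times> {1..j})) (d + j * ?n ^ 6 + ?n ^ 6)
        (?\<tau> + j * (8 / ?n) + 8 / ?n) A' B' F'"
    proof (rule stage_step[OF st])
      show "pairs i \<union> {?l} \<times> {1..j} \<subseteq> pairs ?l" "(?l, Suc j) \<in> pairs ?l"
        "(?l, Suc j) \<notin> pairs i \<union> {?l} \<times> {1..j}"
        using Suc.prems by (auto simp: pairs_def)
      show "?l \<le> t" by fact
      have "?n ^ 12 \<le> ?n ^ 20" using n by (intro power_increasing) auto
      then show "d + j * ?n ^ 6 + ?n ^ 6 \<le> ?n ^ 20"
        using d_le[OF Suc.prems] by simp
      show "0 \<le> ?\<tau> + j * (8 / ?n)" using \<tau>_nonneg by simp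
      have "Suc j * (8 / real ?n) \<le> ?l * (8 / ?n)"
        using Suc.prems by (intro mult_right_mono) auto
      then have "?\<tau> + j * (8 / ?n) + 8 / ?n \<le> (1 - 1 / 2 ^ ?l) / 800"
        using loss \<tau>_Suc Suc_mult by linarith
      also have "\<dots> \<le> 1"
      proof -
        have frac: "(1 - x) / 800 \<le> 1" if "0 \<le> x" for x :: real
          using that by simp
        show ?thesis by (rule frac) simp
      qed
      finally show "?\<tau> + j * (8 / ?n) + 8 / ?n \<le> 1" .
    qed
    moreover have "insert (?l, Suc j) (pairs i \<union> {?l} \<times> {1..j}) = pairs i \<union> {?l} \<times> {1..Suc j}"
      by auto
    moreover have "d + j * ?n ^ 6 + ?n ^ 6 = d + Suc j * ?n ^ 6"
      "?\<tau> + j * (8 / ?n) + 8 / ?n = ?\<tau> + Suc j * (8 / ?n)"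
      using Suc_mult by simp_all
    ultimately show ?case by (simp only:)
  qed
  then obtain A B F where "stage (pairs i \<union> {?l} \<times> {1..?l}) (d + ?l * ?n ^ 6) (?\<tau> + ?l * (8 / ?n)) A B F"
    by blast
  moreover have "pairs i \<union> {?l} \<times> {1..?l} = pairs ?l"
    by (auto simp: pairs_def)
  ultimately have "stage (pairs ?l) (d + ?l * ?n ^ 6) (?\<tau> + ?l * (8 / ?n)) A B F"
    by (simp only:)
  then have "stage (pairs ?l) (d + ?l * ?n ^ 6) ((1 - 1 / 2 ^ ?l) / 800) A B F"
    by (rule stage_mono) (use loss \<tau>_Suc in linarith)
  moreover have "d + ?l * ?n ^ 6 \<le> n (Suc ?l) ^ 3"
    using d_le[of ?l] by (simp add: n_seq_Suc flip: power_mult)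
  ultimately show ?case by blast
qed

lemma exists_hard_input:
  obtains X Y where "(X, Y) \<in> input_vectors C t"
    "\<And>i j s. (i, j) \<in> pairs t \<Longrightarrow> pmf (output_distribution (Q i j) X Y) s > 0.6 \<Longrightarrow>
      \<not> xor_missing_string_solution (n i) (m i) (X i) (Y i) s"
proof -
  obtain d A B F where st: "stage (pairs t) d ((1 - 1 / 2 ^ t) / 800) A B F"
    using stage_levels[of t] by blast
  then have sub: "A \<subseteq> \<Omega>" "B \<subseteq> \<Omega>" and ne: "A \<noteq> {}" "B \<noteq> {}"
    by (auto simp: stage_def)
  have "finite A" "finite B" using sub finite_\<Omega> finite_subset by blast+
  then obtain X Y where XY: "X \<in> A" "Y \<in> B"
    and err_XY: "total_error (pairs t) F X Y \<le> rect_mean A B (total_error (pairs t) F)"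
    using exists_le_rect_mean ne by blast
  note err_XY
  also have "\<dots> \<le> (1 - 1 / 2 ^ t) / 800" using st by (simp add: stage_def)
  \<comment> \<open>The left side is below 1 / 800, while 0.05 ^ 2 = 1 / 400.\<close>
  also have "\<dots> < (0.05)\<^sup>2" by (simp add: power2_eq_square field_simps add_pos_pos)
  finally have err: "total_error (pairs t) F X Y < (0.05)\<^sup>2" .
  have "\<not> xor_missing_string_solution (n i) (m i) (X i) (Y i) s"
    if ij: "(i, j) \<in> pairs t" and p: "pmf (output_distribution (Q i j) X Y) s > 0.6" for i j s
  proof
    assume sol: "xor_missing_string_solution (n i) (m i) (X i) (Y i) s"
    then have "s \<in> bitstrings (n i)" by (simp add: xor_missing_string_solution_def)
    then have "(F (i, j) s - pmf (output_distribution (Q i j) X Y) s)\<^sup>2 \<le> sq_error (n i) (Q i j) (F (i, j)) X Y"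
      by (rule sq_error_ge)
    also have "\<dots> \<le> total_error (pairs t) F X Y"
      unfolding total_error_def using ij finite_pairs
      by (intro order_trans[OF _ member_le_sum[of "(i, j)"]]) (auto simp: sq_error_nonneg)
    also note err
    finally have "\<bar>F (i, j) s - pmf (output_distribution (Q i j) X Y) s\<bar>\<^sup>2 < (0.05)\<^sup>2"
      by (simp only: power2_abs)
    then have "\<bar>F (i, j) s - pmf (output_distribution (Q i j) X Y) s\<bar> < 0.05"
      by (rule power2_less_imp_less) simp
    then have "F (i, j) s > 0.55" using p by (simp add: power2_eq_square abs_if split: if_splits)
    then show False
      using st ij XY sol unfolding stage_def by fastforce
  qed
  moreover have "(X, Y) \<in> input_vectors C t" using XY sub by (auto simp: input_vectors_eq)
  ultimately show ?thesis using that by blast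
qed

end

section \<open>From 0.6 to the threshold p_t, and uniqueness of a majority output\<close>

lemma p_seq_ge: "0.6 \<le> p_seq i"
proof (induction i)
  case (Suc i)
  show ?case
  proof (cases "i = 0")
    case False
    then show ?thesis using Suc by (simp add: p_seq.simps[of "Suc i"] add_increasing2)
  qed (simp add: p_seq.simps)
qed (simp add: p_seq.simps)

lemma pmf_majority_unique:
  assumes "pmf p s > 1 / 2" "pmf p s' > 1 / 2"
  shows "s' = s"
proof (rule ccontr)
  assume "s' \<noteq> s"
  then have "measure_pmf.prob p {s, s'} = pmf p s + pmf p s'"
    by (simp add: measure_measure_pmf_finite)
  then show False
    using assms measure_pmf.prob_le_1[of p "{s, s'}"] by linarith
qed

theorem theorem4p1:
  "\<exists>C0::nat. \<forall>C\<ge>C0. \<forall>t\<ge>1.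
     \<forall>Q :: nat \<Rightarrow> nat \<Rightarrow>
        (nat \<Rightarrow> bool list list, nat \<Rightarrow> bool list list, bool list) randomized_protocol.
       (\<forall>i j. 1 \<le> j \<and> j \<le> i \<and> i \<le> t \<longrightarrow>
          complexity (input_vectors C t) (Q i j) \<le> n_seq C i ^ 4 \<and>
          outputs_strings_of_length (input_vectors C t) (Q i j) (n_seq C i))
       \<longrightarrow>
       (\<exists>X Y. (X, Y) \<in> input_vectors C t \<and>
          (\<forall>i j. 1 \<le> j \<and> j \<le> i \<and> i \<le> t \<longrightarrow>
             (\<nexists>s. pmf (output_distribution (Q i j) X Y) s > p_seq t) \<or>
             (\<exists>s. pmf (output_distribution (Q i j) X Y) s > p_seq t \<and>
                (\<forall>s'. pmf (output_distribution (Q i j) X Y) s' > p_seq t \<longrightarrow> s' = s) \<and>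
                \<not> xor_missing_string_solution (n_seq C i) (m_seq C i) (X i) (Y i) s)))"
proof (intro exI[of _ 14] allI impI)
  fix C t :: nat
    and Q :: "nat \<Rightarrow> nat \<Rightarrow> (nat \<Rightarrow> bool list list, nat \<Rightarrow> bool list list, bool list) randomized_protocol"
  assume "14 \<le> C" "1 \<le> t" and Q: "\<forall>i j. 1 \<le> j \<and> j \<le> i \<and> i \<le> t \<longrightarrow>
    complexity (input_vectors C t) (Q i j) \<le> n_seq C i ^ 4 \<and>
    outputs_strings_of_length (input_vectors C t) (Q i j) (n_seq C i)"
  then interpret protocol_family C t Q by unfold_locales auto
  obtain X Y where XY: "(X, Y) \<in> input_vectors C t"
    and hard: "\<And>i j s. (i, j) \<in> pairs t \<Longrightarrow> pmf (output_distribution (Q i j) X Y) s > 0.6 \<Longrightarrow>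
      \<not> xor_missing_string_solution (n_seq C i) (m_seq C i) (X i) (Y i) s"
    using exists_hard_input by blast
  have "(\<nexists>s. pmf (output_distribution (Q i j) X Y) s > p_seq t) \<or>
      (\<exists>s. pmf (output_distribution (Q i j) X Y) s > p_seq t \<and>
         (\<forall>s'. pmf (output_distribution (Q i j) X Y) s' > p_seq t \<longrightarrow> s' = s) \<and>
         \<not> xor_missing_string_solution (n_seq C i) (m_seq C i) (X i) (Y i) s)"
    if "1 \<le> j \<and> j \<le> i \<and> i \<le> t" for i j
  proof (cases "\<exists>s. pmf (output_distribution (Q i j) X Y) s > p_seq t")
    case True
    then obtain s where s: "pmf (output_distribution (Q i j) X Y) s > p_seq t" by blast
    have "s' = s" if "pmf (output_distribution (Q i j) X Y) s' > p_seq t" for s'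
      using s that p_seq_ge[of t] by (intro pmf_majority_unique[of "output_distribution (Q i j) X Y"]) auto
    moreover have "\<not> xor_missing_string_solution (n_seq C i) (m_seq C i) (X i) (Y i) s"
      using s that p_seq_ge[of t] by (intro hard) (auto simp: pairs_def)
    ultimately show ?thesis using s by blast
  qed blast
  with XY show "\<exists>X Y. (X, Y) \<in> input_vectors C t \<and>
      (\<forall>i j. 1 \<le> j \<and> j \<le> i \<and> i \<le> t \<longrightarrow>
         (\<nexists>s. pmf (output_distribution (Q i j) X Y) s > p_seq t) \<or>
         (\<exists>s. pmf (output_distribution (Q i j) X Y) s > p_seq t \<and>
            (\<forall>s'. pmf (output_distribution (Q i j) X Y) s' > p_seq t \<longrightarrow> s' = s) \<and>
            \<not> xor_missing_string_solution (n_seq C i) (m_seq C i) (X i) (Y i) s))"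
    by blast
qed

end
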